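(* Let $(M_1,F_1)$ and $(M_2,F_2)$ be Finsler manifolds of dimensions $n$ and $m$, let $f:M_1\to\mathbb{R}$ be a smooth nowhere vanishing function, and let $(M,F)$ be the warped product Finsler manifold $M=M_1\times M_2$, $F=\sqrt{F_1^2+f^2F_2^2}$. Let $G$ and $J$ be the Sasaki-type metric and the almost complex structure on the tangent bundle defined in the context. Then $TM$ (with $J$ and $G$) is a Kähler manifold if and only if the horizontal distribution $HTM:=\left\langle\frac{\delta^*}{\delta^*\mathbf{x}^1},\dots,\frac{\delta^*}{\delta^*\mathbf{x}^{n+m}}\right\rangle$ is integrable.
   Context: Local coordinates: $(x^i,y^i)$ on $TM_1$ and $(u^\alpha,v^\alpha)$ on $TM_2$ ($i,j=1,\dots,n$; $\alpha,\beta=1,\dots,m$). $TM^0:=TM_1^0\oplus TM_2^0$ (nonzero tangent vectors in each factor); $F$ and all objects below are defined on $TM^0$. Write $g_{ij}=\frac12\frac{\partial^2F_1^2}{\partial y^i\partial y^j}$, $g_{\alpha\beta}=\frac12\frac{\partial^2F_2^2}{\partial v^\alpha\partial v^\beta}$ with inverses $g^{ij}$, $g^{\alpha\beta}$. Let $G^i=\frac14 g^{ih}\big(\frac{\partial^2F_1^2}{\partial y^h\partial x^j}y^j-\frac{\partial F_1^2}{\partial x^h}\big)$ be the semi-spray coefficients of $F_1$ and $G^\alpha$ those of $F_2$ (defined analogously). Those of $F$ are $$B^i=G^i-\tfrac14 g^{ij}F_2^2\frac{\partial f^2}{\partial x^j},\qquad B^\alpha=G^\alpha+\tfrac1{4f^2}g^{\alpha\beta}\frac{\partial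 F_2^2}{\partial v^\beta}\frac{\partial f^2}{\partial x^i}y^i.$$ Put $B^i_j=\frac{\partial B^i}{\partial y^j}$, $B^\alpha_j=\frac{\partial B^\alpha}{\partial y^j}$, $B^i_\beta=\frac{\partial B^i}{\partial v^\beta}$, $B^\alpha_\beta=\frac{\partial B^\alpha}{\partial v^\beta}$, and $$\tfrac{\delta^*}{\delta^*x^i}=\tfrac{\partial}{\partial x^i}-B_i^j\tfrac{\partial}{\partial y^j}-B_i^\alpha\tfrac{\partial}{\partial v^\alpha},\quad \tfrac{\delta^*}{\delta^*u^\alpha}=\tfrac{\partial}{\partial u^\alpha}-B_\alpha^\beta\tfrac{\partial}{\partial v^\beta}-B_\alpha^i\tfrac{\partial}{\partial y^i},$$ $$\delta^*y^i=dy^i+B^i_jdx^j+B^i_\alpha du^\alpha,\quad \delta^*v^\alpha=dv^\alpha+B^\alpha_\beta du^\beta+B^\alpha_idx^i.$$ The frame $\frac{\delta^*}{\delta^*\mathbf{x}^a}$, $a=1,\dots,n+m$, consists of the $\frac{\delta^*}{\delta^*x^i}$ (for $a=i$) and the $\frac{\delta^*}{\delta^*u^\alpha}$ (for $a=n+\alpha$). Metric: $G=g_{ij}dx^idx^j+f^2g_{\alpha\beta}du^\alpha du^\beta+g_{ij}\delta^*y^i\delta^*y^j+f^2g_{\alpha\beta}\delta^*v^\alpha\delta^*v^\beta$. Almost complex structure: $J\frac{\partial}{\partial y^i}=\frac{\delta^*}{\delta^*x^i}$, $J\frac{\delta^*}{\delta^*x^i}=-\frac{\partial}{\partial y^i}$,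 $J\frac{\partial}{\partial v^\alpha}=\frac{\delta^*}{\delta^*u^\alpha}$, $J\frac{\delta^*}{\delta^*u^\alpha}=-\frac{\partial}{\partial v^\alpha}$. Kähler means: $G$ is $J$-Hermitian, the 2-form $\Omega(X,Y)=G(X,JY)$ is closed, and $J$ is integrable (vanishing Nijenhuis tensor $N_J(X,Y)=[JX,JY]-J[JX,Y]-J[X,JY]-[X,Y]$). *)

theory Defs
  imports "HOL-Analysis.Analysis"
begin

section \<open>Smooth functions on open sets\<close>

text \<open>Intended for open sets in finite-dimensional spaces.\<close>

primrec Ck_on :: "nat \<Rightarrow> ('a::real_normed_vector \<Rightarrow> 'b::real_normed_vector) \<Rightarrow> 'a set \<Rightarrow> bool" where
  "Ck_on 0 f S \<longleftrightarrow> continuous_on S f"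
| "Ck_on (Suc k) f S \<longleftrightarrow> (\<forall>x\<in>S. f differentiable (at x)) \<and>
     (\<forall>v. Ck_on k (\<lambda>x. frechet_derivative f (at x) v) S)"

definition smooth_on :: "'a set \<Rightarrow> ('a::real_normed_vector \<Rightarrow> 'b::real_normed_vector) \<Rightarrow> bool" where
  "smooth_on S f \<longleftrightarrow> (\<forall>k. Ck_on k f S)"

text \<open>Derivative in the constant direction \<open>v\<close>; it is used for partial derivatives.\<close>

definition pdiff :: "'a \<Rightarrow> ('a::real_normed_vector \<Rightarrow> real) \<Rightarrow> 'a \<Rightarrow> real" where
  "pdiff v h p = frechet_derivative h (at p) v"


section \<open>Smooth manifolds and tangent vectors\<close>

type_synonym ('a, 'n) chart = "'a set \<times> ('a \<Rightarrow> real ^ 'n)"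

definition chart_image :: "('a, 'n::finite) chart \<Rightarrow> (real ^ 'n) set" where
  "chart_image c = snd c ` fst c"

definition chart_inv :: "('a, 'n::finite) chart \<Rightarrow> real ^ 'n \<Rightarrow> 'a" where
  "chart_inv c = inv_into (fst c) (snd c)"

definition transition :: "('a, 'n::finite) chart \<Rightarrow> ('a, 'n) chart \<Rightarrow> real ^ 'n \<Rightarrow> real ^ 'n" where
  "transition c d = snd d \<circ> chart_inv c"

definition smooth_manifold :: "'a topology \<Rightarrow> ('a, 'n::finite) chart set \<Rightarrow> bool" where
  "smooth_manifold X A \<longleftrightarrow>
     Hausdorff_space X \<and> second_countable X \<and>
     (\<Union>c\<in>A. fst c) = topspace X \<and>
     (\<forall>c\<in>A. openin X (fst c) \<and> open (chart_image c) \<and>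
        homeomorphic_map (subtopology X (fst c)) (top_of_set (chart_image c)) (snd c)) \<and>
     (\<forall>c\<in>A. \<forall>d\<in>A. smooth_on (snd c ` (fst c \<inter> fst d)) (transition c d))"

definition smooth_function :: "('a, 'n::finite) chart set \<Rightarrow> ('a \<Rightarrow> real) \<Rightarrow> bool" where
  "smooth_function A f \<longleftrightarrow> (\<forall>c\<in>A. smooth_on (chart_image c) (f \<circ> chart_inv c))"

text \<open>
  A tangent vector at \<open>p\<close> is the family of its component vectors in all charts around \<open>p\<close>,
  related by the Jacobians of the transition maps. The value \<open>0\<close> at the remaining arguments
  only makes the representation unique.
\<close>

type_synonym ('a, 'n) tangent = "('a, 'n) chart \<Rightarrow> real ^ 'n"

definition tangent_space :: "('a, 'n::finite) chart set \<Rightarrow> 'a \<Rightarrow> ('a, 'n) tangent set" where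
  "tangent_space A p = {\<xi>.
     (\<forall>c. \<not> (c \<in> A \<and> p \<in> fst c) \<longrightarrow> \<xi> c = 0) \<and>
     (\<forall>c\<in>A. \<forall>d\<in>A. p \<in> fst c \<and> p \<in> fst d \<longrightarrow>
        \<xi> d = frechet_derivative (transition c d) (at (snd c p)) (\<xi> c))}"

text \<open>The tangent vector with components \<open>y\<close> in the chart \<open>c\<close>, at the point with coordinates \<open>x\<close>.\<close>

definition tangent_of :: "('a, 'n::finite) chart set \<Rightarrow> ('a, 'n) chart \<Rightarrow>
    (real ^ 'n) \<times> (real ^ 'n) \<Rightarrow> 'a \<times> ('a, 'n) tangent" where
  "tangent_of A c = (\<lambda>(x, y). (chart_inv c x,
     \<lambda>d. if d \<in> A \<and> chart_inv c x \<in> fst d then frechet_derivative (transition c d) (at x) y else 0))"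


section \<open>Finsler manifolds\<close>

abbreviation Dx :: "'n::finite \<Rightarrow> (real ^ 'n) \<times> (real ^ 'n)" where "Dx i \<equiv> (axis i 1, 0)"
abbreviation Dy :: "'n::finite \<Rightarrow> (real ^ 'n) \<times> (real ^ 'n)" where "Dy i \<equiv> (0, axis i 1)"

text \<open>In the next two definitions \<open>F\<close> is a function of the bundle coordinates \<open>(x, y)\<close>.\<close>

definition fund_tensor :: "((real ^ 'n) \<times> (real ^ 'n) \<Rightarrow> real) \<Rightarrow> (real ^ 'n) \<times> (real ^ 'n) \<Rightarrow> real ^ 'n ^ 'n::finite" where
  "fund_tensor F p = (\<chi> i j. 1/2 * pdiff (Dy i) (pdiff (Dy j) (\<lambda>q. (F q)\<^sup>2)) p)"

definition semispray :: "((real ^ 'n) \<times> (real ^ 'n) \<Rightarrow> real) \<Rightarrow> (real ^ 'n) \<times> (real ^ 'n) \<Rightarrow> real ^ 'n::finite" where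
  "semispray F p = (\<chi> i. 1/4 * (\<Sum>h\<in>UNIV. matrix_inv (fund_tensor F p) $ i $ h *
     ((\<Sum>j\<in>UNIV. pdiff (Dy h) (pdiff (Dx j) (\<lambda>q. (F q)\<^sup>2)) p * snd p $ j)
       - pdiff (Dx h) (\<lambda>q. (F q)\<^sup>2) p)))"

definition slit_dom :: "('a, 'n::finite) chart \<Rightarrow> ((real ^ 'n) \<times> (real ^ 'n)) set" where
  "slit_dom c = chart_image c \<times> (- {0})"

definition finsler_manifold :: "'a topology \<Rightarrow> ('a, 'n::finite) chart set \<Rightarrow>
    ('a \<times> ('a, 'n) tangent \<Rightarrow> real) \<Rightarrow> bool" where
  "finsler_manifold X A F \<longleftrightarrow> smooth_manifold X A \<and>
     (\<forall>p\<in>topspace X. \<forall>\<xi>\<in>tangent_space A p.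
        0 \<le> F (p, \<xi>) \<and> (\<forall>t>0. F (p, \<lambda>c. t *\<^sub>R \<xi> c) = t * F (p, \<xi>))) \<and>
     (\<forall>c\<in>A. smooth_on (slit_dom c) (F \<circ> tangent_of A c) \<and>
        (\<forall>q\<in>slit_dom c. \<forall>w. w \<noteq> 0 \<longrightarrow> 0 < w \<bullet> (fund_tensor (F \<circ> tangent_of A c) q *v w)))"

definition warped_metric :: "('a \<times> ('a, 'n::finite) tangent \<Rightarrow> real) \<Rightarrow> ('a \<Rightarrow> real) \<Rightarrow>
    ('b \<times> ('b, 'm::finite) tangent \<Rightarrow> real) \<Rightarrow>
    ('a \<times> ('a, 'n) tangent) \<times> ('b \<times> ('b, 'm) tangent) \<Rightarrow> real" where
  "warped_metric F1 f F2 = (\<lambda>(P, Q). sqrt ((F1 P)\<^sup>2 + (f (fst P))\<^sup>2 * (F2 Q)\<^sup>2))"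


section \<open>The slit tangent bundle of the warped product in coordinates\<close>

text \<open>
  Points and tangent vectors of the slit tangent bundle are written \<open>((x, y), (u, v))\<close> in bundle
  coordinates. In this section \<open>F1\<close>, \<open>f\<close>, \<open>F2\<close> are functions of \<open>(x, y)\<close>, \<open>x\<close>, \<open>(u, v)\<close>.
\<close>

type_synonym ('n, 'm) coords = "((real ^ 'n) \<times> (real ^ 'n)) \<times> ((real ^ 'm) \<times> (real ^ 'm))"

abbreviation "crd_x q \<equiv> fst (fst q)"
abbreviation "crd_y q \<equiv> snd (fst q)"
abbreviation "crd_u q \<equiv> fst (snd q)"
abbreviation "crd_v q \<equiv> snd (snd q)"

abbreviation ex :: "'n::finite \<Rightarrow> ('n, 'm::finite) coords" where "ex i \<equiv> (Dx i, 0)"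
abbreviation ey :: "'n::finite \<Rightarrow> ('n, 'm::finite) coords" where "ey i \<equiv> (Dy i, 0)"
abbreviation eu :: "'m::finite \<Rightarrow> ('n::finite, 'm) coords" where "eu a \<equiv> (0, Dx a)"
abbreviation ev :: "'m::finite \<Rightarrow> ('n::finite, 'm) coords" where "ev a \<equiv> (0, Dy a)"

type_synonym ('n, 'm, 'r) warped_op =
  "((real ^ 'n) \<times> (real ^ 'n) \<Rightarrow> real) \<Rightarrow> (real ^ 'n \<Rightarrow> real) \<Rightarrow> ((real ^ 'm) \<times> (real ^ 'm) \<Rightarrow> real) \<Rightarrow>
   ('n, 'm) coords \<Rightarrow> 'r"

text \<open>
  Semi-spray coefficients of \<open>sqrt (F1\<^sup>2 + f\<^sup>2 F2\<^sup>2)\<close>: \<open>B1\<close> is $B^i$ and \<open>B2\<close> is $B^\<alpha>$.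
\<close>

definition B1 :: "('n::finite, 'm::finite, real ^ 'n) warped_op" where
  "B1 F1 f F2 q = (\<chi> i. semispray F1 (fst q) $ i -
     1/4 * (\<Sum>j\<in>UNIV. matrix_inv (fund_tensor F1 (fst q)) $ i $ j * (F2 (snd q))\<^sup>2 *
              pdiff (axis j 1) (\<lambda>x. (f x)\<^sup>2) (crd_x q)))"

definition B2 :: "('n::finite, 'm::finite, real ^ 'm) warped_op" where
  "B2 F1 f F2 q = (\<chi> a. semispray F2 (snd q) $ a +
     1 / (4 * (f (crd_x q))\<^sup>2) *
       (\<Sum>b\<in>UNIV. \<Sum>i\<in>UNIV. matrix_inv (fund_tensor F2 (snd q)) $ a $ b *
          pdiff (Dy b) (\<lambda>p. (F2 p)\<^sup>2) (snd q) *
          pdiff (axis i 1) (\<lambda>x. (f x)\<^sup>2) (crd_x q) * crd_y q $ i))"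

text \<open>
  \<open>N1 e\<close> and \<open>N2 e\<close> are the derivatives of $B^i$ and $B^\<alpha>$ in the fibre direction \<open>e\<close>:
  $B^i_j$ is the \<open>i\<close>-component of \<open>N1 (ey j)\<close>, and $B^i_\<beta>$ that of \<open>N1 (ev \<beta>)\<close>;
  likewise for $B^\<alpha>_j$ and $B^\<alpha>_\<beta>$.
\<close>

definition N1 :: "('n, 'm) coords \<Rightarrow> ('n::finite, 'm::finite, real ^ 'n) warped_op" where
  "N1 e F1 f F2 q = (\<chi> i. pdiff e (\<lambda>p. B1 F1 f F2 p $ i) q)"

definition N2 :: "('n, 'm) coords \<Rightarrow> ('n::finite, 'm::finite, real ^ 'm) warped_op" where
  "N2 e F1 f F2 q = (\<chi> a. pdiff e (\<lambda>p. B2 F1 f F2 p $ a) q)"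

definition delta_x :: "'n \<Rightarrow> ('n::finite, 'm::finite, ('n, 'm) coords) warped_op" where
  "delta_x i F1 f F2 q = ex i
     - (\<Sum>j\<in>UNIV. (N1 (ey i) F1 f F2 q $ j) *\<^sub>R ey j)
     - (\<Sum>a\<in>UNIV. (N2 (ey i) F1 f F2 q $ a) *\<^sub>R ev a)"

definition delta_u :: "'m \<Rightarrow> ('n::finite, 'm::finite, ('n, 'm) coords) warped_op" where
  "delta_u a F1 f F2 q = eu a
     - (\<Sum>b\<in>UNIV. (N2 (ev a) F1 f F2 q $ b) *\<^sub>R ev b)
     - (\<Sum>i\<in>UNIV. (N1 (ev a) F1 f F2 q $ i) *\<^sub>R ey i)"

definition horizontal_frame :: "'n + 'm \<Rightarrow> ('n::finite, 'm::finite, ('n, 'm) coords) warped_op" where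
  "horizontal_frame k F1 f F2 q =
     (case k of Inl i \<Rightarrow> delta_x i F1 f F2 q | Inr a \<Rightarrow> delta_u a F1 f F2 q)"

definition horizontal_space :: "('n::finite, 'm::finite, ('n, 'm) coords set) warped_op" where
  "horizontal_space F1 f F2 q = span (range (\<lambda>k. horizontal_frame k F1 f F2 q))"

text \<open>The one-forms $\delta^* y^i$ and $\delta^* v^\<alpha>$, evaluated on a tangent vector \<open>w\<close>.\<close>

definition delta_y_form :: "'n \<Rightarrow> ('n::finite, 'm::finite, ('n, 'm) coords \<Rightarrow> real) warped_op" where
  "delta_y_form i F1 f F2 q w = crd_y w $ i
     + (\<Sum>j\<in>UNIV. N1 (ey j) F1 f F2 q $ i * crd_x w $ j)
     + (\<Sum>a\<in>UNIV. N1 (ev a) F1 f F2 q $ i * crd_u w $ a)"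

definition delta_v_form :: "'m \<Rightarrow> ('n::finite, 'm::finite, ('n, 'm) coords \<Rightarrow> real) warped_op" where
  "delta_v_form a F1 f F2 q w = crd_v w $ a
     + (\<Sum>b\<in>UNIV. N2 (ev b) F1 f F2 q $ a * crd_u w $ b)
     + (\<Sum>i\<in>UNIV. N2 (ey i) F1 f F2 q $ a * crd_x w $ i)"

definition sasaki_metric ::
    "('n::finite, 'm::finite, ('n, 'm) coords \<Rightarrow> ('n, 'm) coords \<Rightarrow> real) warped_op" where
  "sasaki_metric F1 f F2 q w z =
     (\<Sum>i\<in>UNIV. \<Sum>j\<in>UNIV. fund_tensor F1 (fst q) $ i $ j * crd_x w $ i * crd_x z $ j)
   + (\<Sum>a\<in>UNIV. \<Sum>b\<in>UNIV. (f (crd_x q))\<^sup>2 * fund_tensor F2 (snd q) $ a $ b * crd_u w $ a * crd_u z $ b)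
   + (\<Sum>i\<in>UNIV. \<Sum>j\<in>UNIV. fund_tensor F1 (fst q) $ i $ j *
        delta_y_form i F1 f F2 q w * delta_y_form j F1 f F2 q z)
   + (\<Sum>a\<in>UNIV. \<Sum>b\<in>UNIV. (f (crd_x q))\<^sup>2 * fund_tensor F2 (snd q) $ a $ b *
        delta_v_form a F1 f F2 q w * delta_v_form b F1 f F2 q z)"

text \<open>
  The forms $dx^i$, $du^\<alpha>$, $\delta^* y^i$, $\delta^* v^\<alpha>$ are the coframe dual to
  $\delta^*/\delta^* x^i$, $\delta^*/\delta^* u^\<alpha>$, $\partial/\partial y^i$,
  $\partial/\partial v^\<alpha>$, so this is the linear map with the values on the
  frame recorded in \<open>acs_frame\<close>.
\<close>

definition acs :: "('n::finite, 'm::finite, ('n, 'm) coords \<Rightarrow> ('n, 'm) coords) warped_op" where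
  "acs F1 f F2 q w =
     (\<Sum>i\<in>UNIV. delta_y_form i F1 f F2 q w *\<^sub>R delta_x i F1 f F2 q - crd_x w $ i *\<^sub>R ey i)
   + (\<Sum>a\<in>UNIV. delta_v_form a F1 f F2 q w *\<^sub>R delta_u a F1 f F2 q - crd_u w $ a *\<^sub>R ev a)"

lemma delta_x_coords:
  "crd_x (delta_x i F1 f F2 q) = axis i 1" "crd_y (delta_x i F1 f F2 q) = - N1 (ey i) F1 f F2 q"
  "crd_u (delta_x i F1 f F2 q) = 0" "crd_v (delta_x i F1 f F2 q) = - N2 (ey i) F1 f F2 q"
  by (simp_all add: delta_x_def fst_sum snd_sum vec_eq_iff axis_def if_distrib cong: if_cong)

lemma delta_u_coords:
  "crd_x (delta_u a F1 f F2 q) = 0" "crd_y (delta_u a F1 f F2 q) = - N1 (ev a) F1 f F2 q"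
  "crd_u (delta_u a F1 f F2 q) = axis a 1" "crd_v (delta_u a F1 f F2 q) = - N2 (ev a) F1 f F2 q"
  by (simp_all add: delta_u_def fst_sum snd_sum vec_eq_iff axis_def if_distrib cong: if_cong)

lemma delta_form_dual:
  "delta_y_form i F1 f F2 q (delta_x j F1 f F2 q) = 0"
  "delta_y_form i F1 f F2 q (delta_u a F1 f F2 q) = 0"
  "delta_y_form i F1 f F2 q (ey j) = (if i = j then 1 else 0)"
  "delta_y_form i F1 f F2 q (ev a) = 0"
  "delta_v_form a F1 f F2 q (delta_x j F1 f F2 q) = 0"
  "delta_v_form a F1 f F2 q (delta_u b F1 f F2 q) = 0"
  "delta_v_form a F1 f F2 q (ey j) = 0"
  "delta_v_form a F1 f F2 q (ev b) = (if a = b then 1 else 0)"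
  unfolding delta_y_form_def delta_v_form_def delta_x_coords delta_u_coords
  by (simp_all add: axis_def if_distrib cong: if_cong)

lemma acs_linear:
  fixes q :: "('n::finite, 'm::finite) coords"
  shows "linear (acs F1 f F2 q)"
proof (rule linearI)
  fix w z :: "('n, 'm) coords" and r :: real
  have add: "delta_y_form i F1 f F2 q (w + z) = delta_y_form i F1 f F2 q w + delta_y_form i F1 f F2 q z"
    "delta_v_form a F1 f F2 q (w + z) = delta_v_form a F1 f F2 q w + delta_v_form a F1 f F2 q z" for i a
    by (simp_all add: delta_y_form_def delta_v_form_def algebra_simps sum.distrib)
  have scale: "delta_y_form i F1 f F2 q (r *\<^sub>R w) = r * delta_y_form i F1 f F2 q w"
    "delta_v_form a F1 f F2 q (r *\<^sub>R w) = r * delta_v_form a F1 f F2 q w" for i a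
    by (simp_all add: delta_y_form_def delta_v_form_def algebra_simps sum_distrib_left)
  show "acs F1 f F2 q (w + z) = acs F1 f F2 q w + acs F1 f F2 q z"
    by (simp add: acs_def add scaleR_add_left sum.distrib sum_subtractf prod_eq_iff fst_sum snd_sum)
  show "acs F1 f F2 q (r *\<^sub>R w) = r *\<^sub>R acs F1 f F2 q w"
    by (simp add: acs_def scale scaleR_add_right scaleR_right_diff_distrib scaleR_sum_right
        flip: scaleR_scaleR)
qed

lemma acs_frame:
  "acs F1 f F2 q (ey i) = delta_x i F1 f F2 q"
  "acs F1 f F2 q (delta_x i F1 f F2 q) = - ey i"
  "acs F1 f F2 q (ev a) = delta_u a F1 f F2 q"
  "acs F1 f F2 q (delta_u a F1 f F2 q) = - ev a"
  unfolding acs_def delta_form_dual delta_x_coords delta_u_coords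
  by (simp_all add: prod_eq_iff fst_sum snd_sum vec_eq_iff axis_def if_distrib [of "\<lambda>t. t *\<^sub>R _"]
      if_distrib [of "\<lambda>t. t * _"] if_distrib [of uminus] if_distrib [of "\<lambda>w. w $ _"]
      if_distrib [of fst] if_distrib [of snd] sum_negf cong: if_cong)

definition bundle_dom :: "('a, 'n::finite) chart \<Rightarrow> ('b, 'm::finite) chart \<Rightarrow> ('n, 'm) coords set" where
  "bundle_dom c d = slit_dom c \<times> slit_dom d"


section \<open>Kaehler structures and integrable distributions on open sets\<close>

definition lie_bracket :: "('e::real_normed_vector \<Rightarrow> 'e) \<Rightarrow> ('e \<Rightarrow> 'e) \<Rightarrow> 'e \<Rightarrow> 'e" where
  "lie_bracket X Y p = frechet_derivative Y (at p) (X p) - frechet_derivative X (at p) (Y p)"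

definition nijenhuis :: "('e \<Rightarrow> 'e \<Rightarrow> 'e) \<Rightarrow> ('e::real_normed_vector \<Rightarrow> 'e) \<Rightarrow> ('e \<Rightarrow> 'e) \<Rightarrow> 'e \<Rightarrow> 'e" where
  "nijenhuis J X Y p =
     lie_bracket (\<lambda>q. J q (X q)) (\<lambda>q. J q (Y q)) p
     - J p (lie_bracket (\<lambda>q. J q (X q)) Y p)
     - J p (lie_bracket X (\<lambda>q. J q (Y q)) p)
     - lie_bracket X Y p"

text \<open>
  The exterior derivative of a 2-form \<open>\<omega>\<close>, evaluated on the constant vector fields \<open>X\<close>, \<open>Y\<close>, \<open>Z\<close>,
  whose brackets vanish.
\<close>

definition ext_deriv2 :: "('e::real_normed_vector \<Rightarrow> 'e \<Rightarrow> 'e \<Rightarrow> real) \<Rightarrow> 'e \<Rightarrow> 'e \<Rightarrow> 'e \<Rightarrow> 'e \<Rightarrow> real" where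
  "ext_deriv2 \<omega> p X Y Z =
     pdiff X (\<lambda>q. \<omega> q Y Z) p - pdiff Y (\<lambda>q. \<omega> q X Z) p + pdiff Z (\<lambda>q. \<omega> q X Y) p"

definition kaehler_on :: "'e set \<Rightarrow> ('e::real_normed_vector \<Rightarrow> 'e \<Rightarrow> 'e) \<Rightarrow>
    ('e \<Rightarrow> 'e \<Rightarrow> 'e \<Rightarrow> real) \<Rightarrow> bool" where
  "kaehler_on D J G \<longleftrightarrow>
     (\<forall>p\<in>D. \<forall>X Y. G p (J p X) (J p Y) = G p X Y) \<and>
     (\<forall>p\<in>D. \<forall>X Y Z. ext_deriv2 (\<lambda>q X Y. G q X (J q Y)) p X Y Z = 0) \<and>
     (\<forall>X Y. smooth_on D X \<and> smooth_on D Y \<longrightarrow> (\<forall>p\<in>D. nijenhuis J X Y p = 0))"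

text \<open>
  A parametrised integral manifold of the distribution \<open>H\<close>: an injective immersion whose
  tangent spaces are the spaces of \<open>H\<close>.
\<close>

definition integral_manifold :: "('e::real_normed_vector \<Rightarrow> 'e set) \<Rightarrow> 'w::euclidean_space set \<Rightarrow>
    ('w \<Rightarrow> 'e) \<Rightarrow> bool" where
  "integral_manifold H W \<sigma> \<longleftrightarrow> open W \<and> smooth_on W \<sigma> \<and> inj_on \<sigma> W \<and>
     (\<forall>w\<in>W. inj (frechet_derivative \<sigma> (at w)) \<and> range (frechet_derivative \<sigma> (at w)) = H (\<sigma> w))"

definition integrable_on_coords :: "('n::finite, 'm::finite) coords set \<Rightarrow>
    (('n, 'm) coords \<Rightarrow> ('n, 'm) coords set) \<Rightarrow> bool" where
  "integrable_on_coords D H \<longleftrightarrow>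
     (\<forall>q\<in>D. \<exists>(W :: (real ^ ('n + 'm)) set) \<sigma>. integral_manifold H W \<sigma> \<and> \<sigma> ` W \<subseteq> D \<and> q \<in> \<sigma> ` W)"

text \<open>
  The objects above are tensorial and the conditions local, so they hold on the slit tangent
  bundle iff they hold in all of its bundle charts.
\<close>

definition warped_kaehler :: "('a, 'n::finite) chart set \<Rightarrow> ('a \<times> ('a, 'n) tangent \<Rightarrow> real) \<Rightarrow> ('a \<Rightarrow> real) \<Rightarrow>
    ('b, 'm::finite) chart set \<Rightarrow> ('b \<times> ('b, 'm) tangent \<Rightarrow> real) \<Rightarrow> bool" where
  "warped_kaehler A1 F1 f A2 F2 \<longleftrightarrow> (\<forall>c\<in>A1. \<forall>d\<in>A2.
     kaehler_on (bundle_dom c d)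
       (acs (F1 \<circ> tangent_of A1 c) (f \<circ> chart_inv c) (F2 \<circ> tangent_of A2 d))
       (sasaki_metric (F1 \<circ> tangent_of A1 c) (f \<circ> chart_inv c) (F2 \<circ> tangent_of A2 d)))"

definition horizontal_integrable :: "('a, 'n::finite) chart set \<Rightarrow> ('a \<times> ('a, 'n) tangent \<Rightarrow> real) \<Rightarrow> ('a \<Rightarrow> real) \<Rightarrow>
    ('b, 'm::finite) chart set \<Rightarrow> ('b \<times> ('b, 'm) tangent \<Rightarrow> real) \<Rightarrow> bool" where
  "horizontal_integrable A1 F1 f A2 F2 \<longleftrightarrow> (\<forall>c\<in>A1. \<forall>d\<in>A2.
     integrable_on_coords (bundle_dom c d)
       (horizontal_space (F1 \<circ> tangent_of A1 c) (f \<circ> chart_inv c) (F2 \<circ> tangent_of A2 d)))"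

end

(*
  Let L = F1^2 + f^2 F2^2, let B be its semi-spray coefficients and N = dB/dy the induced nonlinear
  connection. Antisymmetrising the vertical derivative of the equation defining B shows that the
  fundamental form of (G, J) is, up to a constant, the exterior derivative of (dL/dy^a) dx^a; hence it
  is always closed, and G is always Hermitian. The Nijenhuis tensor of J is built from the curvature
  R(a, b) = (delta_a N) b - (delta_b N) a, where the remaining terms cancel because
  dN/dy = d^2B/dy^2 is symmetric. So the Kaehler condition is R = 0. By the Frobenius theorem, R = 0
  is also the integrability of the horizontal distribution.
*)

theory Submission
  imports Defs
begin

section \<open>Calculus of smooth functions\<close>

text \<open>The abstract theory carries no indices: \<open>spray\<close> sees a trivialised tangent
  bundle through two embeddings and two projections, and \<open>lagrangian_spray\<close> adds a
  Lagrangian whose Euler-Lagrange equation \<open>B\<close> solves. The warped product enters by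
  verifying this equation for the given B^i and B^\<alpha>, where positive definiteness turns the
  inverse matrices into solutions of linear systems. Coordinates come grouped by factor as ((x, y),
  (u, v)), whereas a connection sets the base (x, u) against the fibre (y, v); the embeddings hide
  this reordering. Two obstacles shape the rest. \<open>Ck_on\<close> speaks of derivatives in
  constant directions, while frames vary with the point; operator-valued derivatives bridge the gap.
  And integrability means the existence of integral manifolds, not closure under brackets, so zero
  curvature has to produce them: being transversal to the fibres, they are graphs of solutions of Ds
  = -N(x, s), built along rays by a contraction.\<close>

definition dderiv :: "'a \<Rightarrow> ('a::real_normed_vector \<Rightarrow> 'b::real_normed_vector) \<Rightarrow> 'a \<Rightarrow> 'b" where
  "dderiv v f p = frechet_derivative f (at p) v"

lemma pdiff_eq_dderiv: "pdiff = dderiv"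
  by (intro ext) (simp add: pdiff_def dderiv_def)

lemma dderivI: "(f has_derivative f') (at p) \<Longrightarrow> dderiv v f p = f' v"
  by (simp add: dderiv_def flip: frechet_derivative_at)

lemma has_derivative_dderiv:
  "f differentiable at p \<Longrightarrow> (f has_derivative (\<lambda>v. dderiv v f p)) (at p)"
  unfolding dderiv_def by (simp flip: frechet_derivative_works)

text \<open>Functions equal near a point have the same derivatives there, so the choice inside
  \<open>frechet_derivative\<close> is made from the same set; the equality therefore covers points
  of non-differentiability as well.\<close>

lemma dderiv_cong:
  assumes "open S" "\<And>x. x \<in> S \<Longrightarrow> f x = g x" "p \<in> S"
  shows "dderiv v f p = dderiv v g p"
proof -
  have "(f has_derivative f') (at p) \<longleftrightarrow> (g has_derivative f') (at p)" for f'
    using assms has_derivative_transform_within_open[of f f' p UNIV S g]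
      has_derivative_transform_within_open[of g f' p UNIV S f] by auto
  then show ?thesis
    by (simp add: dderiv_def frechet_derivative_def)
qed

section \<open>Closure properties of functions with k continuous derivatives\<close>

lemma Ck_on_Suc_dderiv:
  "Ck_on (Suc k) f S \<longleftrightarrow> (\<forall>x\<in>S. f differentiable at x) \<and> (\<forall>v. Ck_on k (dderiv v f) S)"
  by (simp add: dderiv_def[abs_def])

declare Ck_on.simps(2)[simp del]

lemma Ck_on_cong:
  assumes "open S" "\<And>x. x \<in> S \<Longrightarrow> f x = g x" "Ck_on k f S"
  shows "Ck_on k g S"
  using assms
proof (induction k arbitrary: f g)
  case 0
  then show ?case using continuous_on_cong[of S S f g] by simp
next
  case (Suc k)
  have "g differentiable at x" if "x \<in> S" for x
    using Suc.prems that unfolding Ck_on_Suc_dderiv differentiable_def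
    by (meson has_derivative_transform_within_open)
  moreover have "Ck_on k (dderiv v g) S" for v
  proof (rule Suc.IH[of "dderiv v f", OF Suc.prems(1)])
    show "dderiv v f x = dderiv v g x" if "x \<in> S" for x
      by (rule dderiv_cong[OF Suc.prems(1,2) that])
    show "Ck_on k (dderiv v f) S" using Suc.prems(3) by (simp add: Ck_on_Suc_dderiv)
  qed
  ultimately show ?case by (simp add: Ck_on_Suc_dderiv)
qed

text \<open>Working form of the recursion: an explicit formula \<open>f'\<close> for the derivative
  on the open set takes the place of \<open>frechet_derivative\<close>, and the order is checked on
  that formula.\<close>

lemma Ck_on_SucI:
  assumes "open S" "\<And>x. x \<in> S \<Longrightarrow> (f has_derivative f' x) (at x)"
    and "\<And>v. Ck_on k (\<lambda>x. f' x v) S"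
  shows "Ck_on (Suc k) f S"
proof -
  have "Ck_on k (dderiv v f) S" for v
    by (rule Ck_on_cong[OF assms(1) _ assms(3)[of v]]) (simp add: dderivI[OF assms(2)])
  then show ?thesis using assms(2) by (auto simp: Ck_on_Suc_dderiv differentiable_def)
qed

lemma Ck_on_SucD: "Ck_on (Suc k) f S \<Longrightarrow> Ck_on k f S"
proof (induction k arbitrary: f)
  case 0
  then show ?case
    by (auto simp: Ck_on_Suc_dderiv intro!: continuous_at_imp_continuous_on differentiable_imp_continuous_within)
next
  case (Suc k)
  then show ?case by (meson Ck_on_Suc_dderiv)
qed

lemma Ck_on_imp_continuous_on: "Ck_on k f S \<Longrightarrow> continuous_on S f"
  by (induction k) (auto dest: Ck_on_SucD)

lemma Ck_on_const: "Ck_on k (\<lambda>x. c) S"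
proof (induction k arbitrary: c)
  case (Suc k)
  then show ?case by (simp add: Ck_on_Suc_dderiv dderiv_def[abs_def])
qed simp

lemma Ck_on_bounded_linear:
  assumes L: "bounded_linear L" and "open S" "Ck_on k f S"
  shows "Ck_on k (\<lambda>x. L (f x)) S"
  using assms(3)
proof (induction k arbitrary: f)
  case 0
  then show ?case by (simp add: bounded_linear.continuous_on[OF L])
next
  case (Suc k)
  show ?case
  proof (rule Ck_on_SucI[OF \<open>open S\<close>])
    show "((\<lambda>x. L (f x)) has_derivative (\<lambda>v. L (dderiv v f x))) (at x)" if "x \<in> S" for x
      using Suc.prems that bounded_linear.has_derivative[OF L has_derivative_dderiv]
      by (auto simp: Ck_on_Suc_dderiv)
    show "Ck_on k (\<lambda>x. L (dderiv v f x)) S" for v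
      using Suc by (auto simp: Ck_on_Suc_dderiv)
  qed
qed

lemma Ck_on_add:
  assumes "open S" "Ck_on k f S" "Ck_on k g S"
  shows "Ck_on k (\<lambda>x. f x + g x) S"
  using assms(2,3)
proof (induction k arbitrary: f g)
  case 0
  then show ?case by (simp add: continuous_on_add)
next
  case (Suc k)
  show ?case
  proof (rule Ck_on_SucI[OF \<open>open S\<close>])
    show "((\<lambda>x. f x + g x) has_derivative (\<lambda>v. dderiv v f x + dderiv v g x)) (at x)"
      if "x \<in> S" for x
      using Suc.prems that by (auto simp: Ck_on_Suc_dderiv intro!: has_derivative_add has_derivative_dderiv)
    show "Ck_on k (\<lambda>x. dderiv v f x + dderiv v g x) S" for v
      using Suc by (auto simp: Ck_on_Suc_dderiv)
  qed
qed

lemma Ck_on_sum: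
  assumes "open S" "\<And>i. i \<in> I \<Longrightarrow> Ck_on k (f i) S"
  shows "Ck_on k (\<lambda>x. \<Sum>i\<in>I. f i x) S"
  using assms(2)
  by (induction I rule: infinite_finite_induct) (auto intro: Ck_on_const Ck_on_add[OF assms(1)])

text \<open>Leibniz rule. Each term keeps one factor undifferentiated; \<open>Ck_on_SucD\<close>
  lowers that factor from order \<open>Suc k\<close> to \<open>k\<close>, so that the induction
  hypothesis applies to the pair.\<close>

lemma Ck_on_bilinear:
  assumes P: "bounded_bilinear P" and "open S" "Ck_on k f S" "Ck_on k g S"
  shows "Ck_on k (\<lambda>x. P (f x) (g x)) S"
  using assms(3,4)
proof (induction k arbitrary: f g)
  case 0
  then show ?case by (simp add: bounded_bilinear.continuous_on[OF P])
next
  case (Suc k)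
  show ?case
  proof (rule Ck_on_SucI[OF \<open>open S\<close>])
    show "((\<lambda>x. P (f x) (g x)) has_derivative
        (\<lambda>v. P (f x) (dderiv v g x) + P (dderiv v f x) (g x))) (at x)" if "x \<in> S" for x
      using Suc.prems that
      by (auto simp: Ck_on_Suc_dderiv intro!: bounded_bilinear.FDERIV[OF P] has_derivative_dderiv)
    show "Ck_on k (\<lambda>x. P (f x) (dderiv v g x) + P (dderiv v f x) (g x)) S" for v
      using Suc Ck_on_SucD[OF Suc.prems(1)] Ck_on_SucD[OF Suc.prems(2)]
      by (auto simp: Ck_on_Suc_dderiv intro!: Ck_on_add \<open>open S\<close>)
  qed
qed

text \<open>The derivative of the inverse contains the inverse again, so the induction keeps
  \<open>f\<close> fixed and uses the claim one order lower for the same function.\<close>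

lemma Ck_on_inverse:
  fixes f :: "'a::real_normed_vector \<Rightarrow> real"
  assumes "open S" "Ck_on k f S" "\<And>x. x \<in> S \<Longrightarrow> f x \<noteq> 0"
  shows "Ck_on k (\<lambda>x. inverse (f x)) S"
  using assms(2)
proof (induction k)
  case 0
  then show ?case using assms(3) by (simp add: continuous_on_inverse)
next
  case (Suc k)
  show ?case
  proof (rule Ck_on_SucI[OF \<open>open S\<close>])
    show "((\<lambda>x. inverse (f x)) has_derivative
        (\<lambda>v. - (inverse (f x) * dderiv v f x * inverse (f x)))) (at x)" if "x \<in> S" for x
      using Suc.prems that assms(3)
      by (intro Deriv.has_derivative_inverse has_derivative_dderiv) (auto simp: Ck_on_Suc_dderiv)
    have "Ck_on k (\<lambda>x. inverse (f x)) S" using Suc.IH Ck_on_SucD[OF Suc.prems] by blast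
    then show "Ck_on k (\<lambda>x. - (inverse (f x) * dderiv v f x * inverse (f x))) S" for v
      using Suc.prems
      by (auto simp: Ck_on_Suc_dderiv \<open>open S\<close> intro!: Ck_on_bilinear[OF bounded_bilinear_mult]
          Ck_on_bounded_linear[OF bounded_linear_minus[OF bounded_linear_ident]])
  qed
qed

text \<open>The chain rule differentiates \<open>g\<close> in the direction
  \<open>dderiv v f x\<close>, which moves with \<open>x\<close>, while \<open>Ck_on\<close> knows
  only constant directions. Expanding in a basis of the Euclidean middle space leaves finitely many
  constant directions with variable coefficients.\<close>

lemma Ck_on_compose:
  fixes g :: "'b::euclidean_space \<Rightarrow> 'c::real_normed_vector"
  assumes "open S" "open T" "Ck_on k g T" "Ck_on k f S" "f ` S \<subseteq> T"
  shows "Ck_on k (\<lambda>x. g (f x)) S"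
  using assms(3,4)
proof (induction k arbitrary: g)
  case 0
  then show ?case using assms(5) by (auto intro: continuous_on_compose2)
next
  case (Suc k)
  have dg: "g differentiable at (f x)" if "x \<in> S" for x
    using Suc.prems that assms(5) by (auto simp: Ck_on_Suc_dderiv)
  have df: "f differentiable at x" if "x \<in> S" for x
    using Suc.prems that by (auto simp: Ck_on_Suc_dderiv)
  show ?case
  proof (rule Ck_on_SucI[OF \<open>open S\<close>])
    fix x assume x: "x \<in> S"
    have "((\<lambda>x. g (f x)) has_derivative (\<lambda>v. dderiv (dderiv v f x) g (f x))) (at x)"
      using diff_chain_at[OF has_derivative_dderiv[OF df[OF x]] has_derivative_dderiv[OF dg[OF x]]]
      by (simp add: o_def)
    also have "(\<lambda>v. dderiv (dderiv v f x) g (f x)) =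
      (\<lambda>v. \<Sum>b\<in>Basis. (dderiv v f x \<bullet> b) *\<^sub>R dderiv b g (f x))"
    proof
      fix v
      interpret linear "\<lambda>v. dderiv v g (f x)"
        using has_derivative_linear[OF has_derivative_dderiv[OF dg[OF x]]] .
      have "dderiv (dderiv v f x) g (f x) =
        dderiv (\<Sum>b\<in>Basis. (dderiv v f x \<bullet> b) *\<^sub>R b) g (f x)"
        by (simp add: euclidean_representation)
      also have "\<dots> = (\<Sum>b\<in>Basis. (dderiv v f x \<bullet> b) *\<^sub>R dderiv b g (f x))"
        by (simp only: sum scale)
      finally show "dderiv (dderiv v f x) g (f x) = (\<Sum>b\<in>Basis. (dderiv v f x \<bullet> b) *\<^sub>R dderiv b g (f x))" .
    qed
    finally show "((\<lambda>x. g (f x)) has_derivative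
      (\<lambda>v. \<Sum>b\<in>Basis. (dderiv v f x \<bullet> b) *\<^sub>R dderiv b g (f x))) (at x)" .
  next
    fix v
    show "Ck_on k (\<lambda>x. \<Sum>b\<in>Basis. (dderiv v f x \<bullet> b) *\<^sub>R dderiv b g (f x)) S"
    proof (intro Ck_on_sum[OF \<open>open S\<close>] Ck_on_bilinear[OF bounded_bilinear_scaleR \<open>open S\<close>])
      show "Ck_on k (\<lambda>x. dderiv v f x \<bullet> b) S" for b
        using Suc.prems
        by (auto simp: Ck_on_Suc_dderiv intro: Ck_on_bounded_linear[OF bounded_linear_inner_left \<open>open S\<close>])
      show "Ck_on k (\<lambda>x. dderiv b g (f x)) S" for b
        using Suc.prems Ck_on_SucD[OF Suc.prems(2)] by (intro Suc.IH) (auto simp: Ck_on_Suc_dderiv)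
    qed
  qed
qed

section \<open>Smooth functions\<close>

lemma smooth_on_dderiv: "smooth_on S f \<Longrightarrow> smooth_on S (dderiv v f)"
  unfolding smooth_on_def by (meson Ck_on_Suc_dderiv)

lemma smooth_on_differentiable: "smooth_on S f \<Longrightarrow> x \<in> S \<Longrightarrow> f differentiable at x"
  unfolding smooth_on_def by (meson Ck_on_Suc_dderiv)

lemma smooth_on_has_derivative:
  "smooth_on S f \<Longrightarrow> x \<in> S \<Longrightarrow> (f has_derivative (\<lambda>v. dderiv v f x)) (at x)"
  by (intro has_derivative_dderiv smooth_on_differentiable)

lemma smooth_on_linear_dderiv: "smooth_on S f \<Longrightarrow> x \<in> S \<Longrightarrow> linear (\<lambda>v. dderiv v f x)"
  by (rule has_derivative_linear[OF smooth_on_has_derivative])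

lemma smooth_on_continuous_on: "smooth_on S f \<Longrightarrow> continuous_on S f"
  unfolding smooth_on_def using Ck_on.simps(1) by blast

lemma smooth_on_cong:
  "smooth_on S f \<Longrightarrow> open S \<Longrightarrow> (\<And>x. x \<in> S \<Longrightarrow> f x = g x) \<Longrightarrow> smooth_on S g"
  unfolding smooth_on_def using Ck_on_cong by blast

lemma smooth_on_const: "smooth_on S (\<lambda>x. c)"
  by (simp add: smooth_on_def Ck_on_const)

lemma smooth_on_bounded_linear:
  "bounded_linear L \<Longrightarrow> open S \<Longrightarrow> smooth_on S f \<Longrightarrow> smooth_on S (\<lambda>x. L (f x))"
  by (simp add: smooth_on_def Ck_on_bounded_linear)

lemma smooth_on_ident: "open S \<Longrightarrow> smooth_on S (\<lambda>x. x)"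
  unfolding smooth_on_def
proof
  show "Ck_on k (\<lambda>x. x) S" if "open S" for k
    using that by (cases k) (auto intro: Ck_on_SucI[OF _ has_derivative_ident] Ck_on_const)
qed

lemma smooth_on_linear_map: "bounded_linear L \<Longrightarrow> open S \<Longrightarrow> smooth_on S L"
  using smooth_on_bounded_linear[of L S "\<lambda>x. x"] by (simp add: smooth_on_ident)

lemma smooth_on_add:
  "open S \<Longrightarrow> smooth_on S f \<Longrightarrow> smooth_on S g \<Longrightarrow> smooth_on S (\<lambda>x. f x + g x)"
  by (simp add: smooth_on_def Ck_on_add)

lemma smooth_on_minus: "open S \<Longrightarrow> smooth_on S f \<Longrightarrow> smooth_on S (\<lambda>x. - f x)"
  by (rule smooth_on_bounded_linear[OF bounded_linear_minus[OF bounded_linear_ident]])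

lemma smooth_on_diff:
  "open S \<Longrightarrow> smooth_on S f \<Longrightarrow> smooth_on S g \<Longrightarrow> smooth_on S (\<lambda>x. f x - g x)"
  using smooth_on_add[of S f "\<lambda>x. - g x"] by (simp add: smooth_on_minus)

lemma smooth_on_sum:
  "open S \<Longrightarrow> (\<And>i. i \<in> I \<Longrightarrow> smooth_on S (f i)) \<Longrightarrow> smooth_on S (\<lambda>x. \<Sum>i\<in>I. f i x)"
  by (simp add: smooth_on_def Ck_on_sum)

lemma smooth_on_bilinear:
  "bounded_bilinear P \<Longrightarrow> open S \<Longrightarrow> smooth_on S f \<Longrightarrow> smooth_on S g \<Longrightarrow> smooth_on S (\<lambda>x. P (f x) (g x))"
  by (simp add: smooth_on_def Ck_on_bilinear)

lemmas smooth_on_mult = smooth_on_bilinear[OF bounded_bilinear_mult]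
lemmas smooth_on_scaleR = smooth_on_bilinear[OF bounded_bilinear_scaleR]

lemma smooth_on_prod:
  fixes f :: "'i \<Rightarrow> 'a::real_normed_vector \<Rightarrow> 'b::real_normed_field"
  assumes "open S" "\<And>i. i \<in> I \<Longrightarrow> smooth_on S (f i)"
  shows "smooth_on S (\<lambda>x. \<Prod>i\<in>I. f i x)"
  using assms(2)
  by (induction I rule: infinite_finite_induct) (auto intro: smooth_on_const smooth_on_mult[OF assms(1)])

lemma smooth_on_power2:
  fixes f :: "'a::real_normed_vector \<Rightarrow> 'b::real_normed_field"
  shows "open S \<Longrightarrow> smooth_on S f \<Longrightarrow> smooth_on S (\<lambda>x. (f x)\<^sup>2)"
  by (simp add: power2_eq_square smooth_on_mult)

lemma smooth_on_divide:
  fixes f g :: "'a::real_normed_vector \<Rightarrow> real"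
  assumes "open S" "smooth_on S f" "smooth_on S g" "\<And>x. x \<in> S \<Longrightarrow> g x \<noteq> 0"
  shows "smooth_on S (\<lambda>x. f x / g x)"
  unfolding divide_inverse
  using assms by (intro smooth_on_mult) (auto simp: smooth_on_def intro: Ck_on_inverse)

lemma smooth_on_compose:
  fixes g :: "'b::euclidean_space \<Rightarrow> 'c::real_normed_vector"
  assumes "open S" "open T" "smooth_on T g" "smooth_on S f" "\<And>x. x \<in> S \<Longrightarrow> f x \<in> T"
  shows "smooth_on S (\<lambda>x. g (f x))"
  unfolding smooth_on_def
proof
  show "Ck_on k (\<lambda>x. g (f x)) S" for k
    by (rule Ck_on_compose[OF assms(1,2)]) (use assms in \<open>auto simp: smooth_on_def\<close>)
qed

lemma smooth_on_det:
  fixes A :: "'a::real_normed_vector \<Rightarrow> real ^ 'n ^ 'n"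
  assumes "open S" "\<And>i j. smooth_on S (\<lambda>x. A x $ i $ j)"
  shows "smooth_on S (\<lambda>x. det (A x))"
  unfolding det_def
  by (intro smooth_on_sum smooth_on_mult smooth_on_const smooth_on_prod assms)

lemma smooth_on_vec:
  fixes f :: "'a::real_normed_vector \<Rightarrow> real ^ 'n"
  assumes "open S" "\<And>i. smooth_on S (\<lambda>x. f x $ i)"
  shows "smooth_on S f"
proof -
  have "f = (\<lambda>x. \<Sum>i\<in>UNIV. f x $ i *\<^sub>R axis i 1)"
    by (auto simp: vec_eq_iff axis_def if_distrib cong: if_cong)
  moreover have "smooth_on S (\<lambda>x. \<Sum>i\<in>UNIV. f x $ i *\<^sub>R axis i 1 :: real ^ 'n)"
    by (intro smooth_on_sum smooth_on_scaleR smooth_on_const assms)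
  ultimately show ?thesis by simp
qed

lemma smooth_on_Pair:
  assumes "open S" "smooth_on S f" "smooth_on S g"
  shows "smooth_on S (\<lambda>x. (f x, g x))"
proof -
  have "bounded_linear (\<lambda>x::'b. (x, 0::'c))" "bounded_linear (\<lambda>x::'c. (0::'b, x))"
    by (intro bounded_linear_intros)+
  from smooth_on_add[OF assms(1) smooth_on_bounded_linear[OF this(1) assms(1,2)]
      smooth_on_bounded_linear[OF this(2) assms(1,3)]]
  show ?thesis by simp
qed

section \<open>Symmetry of second derivatives\<close>

text \<open>By the mean value theorem the second difference of \<open>f\<close> is a value of either mixed derivative.\<close>

lemma second_difference_mvt:
  fixes f :: "'a::real_normed_vector \<Rightarrow> real"
  assumes S: "\<And>s r. 0 \<le> s \<Longrightarrow> s \<le> t \<Longrightarrow> 0 \<le> r \<Longrightarrow> r \<le> t \<Longrightarrow> p + s *\<^sub>R v + r *\<^sub>R w \<in> S"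
    and f: "\<And>x. x \<in> S \<Longrightarrow> f differentiable at x"
    and fv: "\<And>x. x \<in> S \<Longrightarrow> dderiv v f differentiable at x" and t: "0 < t"
  shows "\<exists>s r. 0 < s \<and> s < t \<and> 0 < r \<and> r < t \<and>
    f (p + t *\<^sub>R v + t *\<^sub>R w) - f (p + t *\<^sub>R v) - f (p + t *\<^sub>R w) + f p =
    t * t * dderiv w (dderiv v f) (p + s *\<^sub>R v + r *\<^sub>R w)"
proof -
  have line: "((\<lambda>s. h (a + s *\<^sub>R e)) has_real_derivative dderiv e h (a + s *\<^sub>R e)) (at s)"
    if "h differentiable at (a + s *\<^sub>R e)" for h :: "'a \<Rightarrow> real" and a e s
  proof -
    have d: "((\<lambda>s. a + s *\<^sub>R e) has_derivative (\<lambda>s. s *\<^sub>R e)) (at s)"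
      by (auto intro!: derivative_eq_intros)
    have l: "linear (\<lambda>v. dderiv v h (a + s *\<^sub>R e))"
      using has_derivative_linear[OF has_derivative_dderiv[OF that]] .
    show ?thesis
      unfolding has_field_derivative_def
      using diff_chain_at[OF d has_derivative_dderiv[OF that]] linear_scale[OF l]
      by (simp add: o_def mult_commute_abs)
  qed
  have d1: "((\<lambda>s. f (p + t *\<^sub>R w + s *\<^sub>R v) - f (p + s *\<^sub>R v)) has_real_derivative
     dderiv v f (p + t *\<^sub>R w + s *\<^sub>R v) - dderiv v f (p + s *\<^sub>R v)) (at s)" if "0 \<le> s" "s \<le> t" for s
    using S[of s t] S[of s 0] that t
    by (intro DERIV_diff line f) (auto simp: algebra_simps)
  then obtain s where s: "0 < s" "s < t" and es:
    "f (p + t *\<^sub>R w + t *\<^sub>R v) - f (p + t *\<^sub>R v) - (f (p + t *\<^sub>R w + 0 *\<^sub>R v) - f (p + 0 *\<^sub>R v)) =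
     (t - 0) * (dderiv v f (p + t *\<^sub>R w + s *\<^sub>R v) - dderiv v f (p + s *\<^sub>R v))"
    using MVT2[OF t d1] by blast
  have d2: "((\<lambda>r. dderiv v f (p + s *\<^sub>R v + r *\<^sub>R w)) has_real_derivative
     dderiv w (dderiv v f) (p + s *\<^sub>R v + r *\<^sub>R w)) (at r)" if "0 \<le> r" "r \<le> t" for r
    using S[of s r] that s by (intro line fv) auto
  then obtain r where r: "0 < r" "r < t" and er:
    "dderiv v f (p + s *\<^sub>R v + t *\<^sub>R w) - dderiv v f (p + s *\<^sub>R v + 0 *\<^sub>R w) =
     (t - 0) * dderiv w (dderiv v f) (p + s *\<^sub>R v + r *\<^sub>R w)"
    using MVT2[OF t d2] by blast
  show ?thesis
    using s r es er by (intro exI[of _ s] exI[of _ r]) (simp add: algebra_simps)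
qed

text \<open>The second difference over the parallelogram with sides \<open>t n *\<^sub>R v\<close>
  and \<open>t n *\<^sub>R w\<close> is symmetric in \<open>v\<close> and \<open>w\<close>. Read in
  both orders, it makes the two mixed derivatives agree at a pair of nearby points; as these tend to
  \<open>p\<close>, continuity gives equality at \<open>p\<close>.\<close>

lemma dderiv_commute_real:
  fixes f :: "'a::real_normed_vector \<Rightarrow> real"
  assumes S: "open S" and f: "Ck_on 2 f S" and p: "p \<in> S"
  shows "dderiv v (dderiv w f) p = dderiv w (dderiv v f) p"
proof -
  have f1: "f differentiable at x" "dderiv e f differentiable at x"
    and c: "continuous_on S (dderiv e (dderiv e' f))" if "x \<in> S" for x e e'
    using f that Ck_on_imp_continuous_on by (auto simp: numeral_2_eq_2 Ck_on_Suc_dderiv)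
  obtain d where d: "0 < d" "ball p d \<subseteq> S" using S p openE by blast
  \<comment> \<open>With this scale the parallelograms stay in the ball; the summand 1 keeps the
    denominator positive and the estimate strict.\<close>
  define c where "c = d / (1 + norm v + norm w)"
  have pos: "0 < 1 + norm v + norm w" using norm_ge_zero[of v] norm_ge_zero[of w] by linarith
  have cpos: "0 < c" using d pos by (simp add: c_def)
  define t where "t n = c / real (n + 1)" for n
  have tc: "0 < t n" "t n \<le> c" for n using cpos by (auto simp: t_def field_simps)
  have t0: "t \<longlonglongrightarrow> 0"
    unfolding t_def using LIMSEQ_Suc[OF lim_const_over_n[of c]] by simp
  have inS: "p + s *\<^sub>R e + r *\<^sub>R e' \<in> S"
    if "0 \<le> s" "s \<le> t n" "0 \<le> r" "r \<le> t n" "e = v \<and> e' = w \<or> e = w \<and> e' = v" for s r n e e'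
  proof -
    have "norm (s *\<^sub>R e + r *\<^sub>R e') \<le> s * norm e + r * norm e'"
      using that norm_triangle_ineq[of "s *\<^sub>R e" "r *\<^sub>R e'"] by simp
    also have "\<dots> \<le> c * norm e + c * norm e'"
      using that tc[of n] by (intro add_mono mult_right_mono) auto
    also have "\<dots> < c * (1 + norm v + norm w)" using that(5) cpos by (auto simp: algebra_simps)
    also have "\<dots> = d" using pos by (simp add: c_def)
    finally have "norm (p + s *\<^sub>R e + r *\<^sub>R e' - p) < d" by (simp add: add.assoc)
    then have "p + s *\<^sub>R e + r *\<^sub>R e' \<in> ball p d"
      by (metis dist_commute dist_norm mem_ball)
    then show ?thesis using d(2) by blast
  qed
  have "\<exists>s r s' r'. 0 < s \<and> s < t n \<and> 0 < r \<and> r < t n \<and> 0 < s' \<and> s' < t n \<and> 0 < r' \<and> r' < t n \<and>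
     dderiv w (dderiv v f) (p + s *\<^sub>R v + r *\<^sub>R w) = dderiv v (dderiv w f) (p + s' *\<^sub>R w + r' *\<^sub>R v)" for n
  proof -
    have mvt: "\<exists>s r. 0 < s \<and> s < t n \<and> 0 < r \<and> r < t n \<and>
      f (p + t n *\<^sub>R e + t n *\<^sub>R e') - f (p + t n *\<^sub>R e) - f (p + t n *\<^sub>R e') + f p =
      t n * t n * dderiv e' (dderiv e f) (p + s *\<^sub>R e + r *\<^sub>R e')"
      if "e = v \<and> e' = w \<or> e = w \<and> e' = v" for e e'
    proof (rule second_difference_mvt[where S = S])
      show "p + s *\<^sub>R e + r *\<^sub>R e' \<in> S" if "0 \<le> s" "s \<le> t n" "0 \<le> r" "r \<le> t n" for s r
        using that \<open>e = v \<and> e' = w \<or> e = w \<and> e' = v\<close> by (rule inS)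
    qed (use f1 tc in auto)
    obtain s r where 1: "0 < s" "s < t n" "0 < r" "r < t n"
      "f (p + t n *\<^sub>R v + t n *\<^sub>R w) - f (p + t n *\<^sub>R v) - f (p + t n *\<^sub>R w) + f p =
         t n * t n * dderiv w (dderiv v f) (p + s *\<^sub>R v + r *\<^sub>R w)"
      using mvt[of v w] by blast
    obtain s' r' where 2: "0 < s'" "s' < t n" "0 < r'" "r' < t n"
      "f (p + t n *\<^sub>R w + t n *\<^sub>R v) - f (p + t n *\<^sub>R w) - f (p + t n *\<^sub>R v) + f p =
         t n * t n * dderiv v (dderiv w f) (p + s' *\<^sub>R w + r' *\<^sub>R v)"
      using mvt[of w v] by blast
    have "t n * t n * dderiv w (dderiv v f) (p + s *\<^sub>R v + r *\<^sub>R w) =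
      t n * t n * dderiv v (dderiv w f) (p + s' *\<^sub>R w + r' *\<^sub>R v)"
      unfolding 1(5)[symmetric] 2(5)[symmetric] by (simp add: algebra_simps)
    with 1 2 tc(1)[of n] show ?thesis by auto
  qed
  then obtain s r s' r' where
    b: "\<And>n. 0 < s n \<and> s n < t n \<and> 0 < r n \<and> r n < t n \<and> 0 < s' n \<and> s' n < t n \<and> 0 < r' n \<and> r' n < t n"
    and e: "\<And>n. dderiv w (dderiv v f) (p + s n *\<^sub>R v + r n *\<^sub>R w) =
      dderiv v (dderiv w f) (p + s' n *\<^sub>R w + r' n *\<^sub>R v)"
    by metis
  have sq: "u \<longlonglongrightarrow> 0" if "\<And>n. 0 < u n \<and> u n < t n" for u
    using that by (intro tendsto_sandwich[OF _ _ tendsto_const t0]) (auto intro!: always_eventually less_imp_le)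
  have lim: "(\<lambda>n. dderiv e (dderiv e' f) (p + a n *\<^sub>R e' + b n *\<^sub>R e)) \<longlonglongrightarrow> dderiv e (dderiv e' f) p"
    if "a \<longlonglongrightarrow> 0" "b \<longlonglongrightarrow> 0" for a b e e'
  proof -
    have "(\<lambda>n. p + a n *\<^sub>R e' + b n *\<^sub>R e) \<longlonglongrightarrow> p + 0 *\<^sub>R e' + 0 *\<^sub>R e"
      by (intro tendsto_intros that)
    moreover have "isCont (dderiv e (dderiv e' f)) p"
      using c[OF p] S p by (simp add: continuous_on_eq_continuous_at)
    ultimately show ?thesis using isCont_tendsto_compose by fastforce
  qed
  have "s \<longlonglongrightarrow> 0" "r \<longlonglongrightarrow> 0" "s' \<longlonglongrightarrow> 0" "r' \<longlonglongrightarrow> 0" using b by (auto intro!: sq)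
  then show ?thesis
    using LIMSEQ_unique[OF lim[of s r w v] lim[of s' r' v w, folded e]] by simp
qed

text \<open>The mean value argument is scalar, so the vector-valued case goes component by
  component; \<open>lin\<close> moves the inner product inside each derivative.\<close>

lemma dderiv_commute:
  fixes f :: "'a::real_normed_vector \<Rightarrow> 'b::euclidean_space"
  assumes S: "open S" and f: "smooth_on S f" and p: "p \<in> S"
  shows "dderiv v (dderiv w f) p = dderiv w (dderiv v f) p"
proof (rule euclidean_eqI)
  fix b :: 'b assume "b \<in> Basis"
  have lin: "dderiv e h x \<bullet> b = dderiv e (\<lambda>x. h x \<bullet> b) x"
    if "smooth_on S h" "x \<in> S" for e x and h :: "'a \<Rightarrow> 'b"
    by (rule dderivI[symmetric])
      (rule bounded_linear.has_derivative[OF bounded_linear_inner_left smooth_on_has_derivative[OF that]])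
  have "dderiv e (dderiv e' f) p \<bullet> b = dderiv e (dderiv e' (\<lambda>x. f x \<bullet> b)) p" for e e'
    unfolding lin[OF smooth_on_dderiv[OF f] p]
    by (rule dderiv_cong[OF S _ p]) (rule lin[OF f])
  moreover have "Ck_on 2 (\<lambda>x. f x \<bullet> b) S"
    using smooth_on_bounded_linear[OF bounded_linear_inner_left S f] by (simp add: smooth_on_def)
  ultimately show "dderiv v (dderiv w f) p \<bullet> b = dderiv w (dderiv v f) p \<bullet> b"
    using dderiv_commute_real[OF S _ p] by metis
qed

section \<open>A Frobenius theorem\<close>

text \<open>A Gronwall bound free of exponentials: on an interval of length 1 the mean value
  inequality at a maximum point \<open>s\<close> of the norm gives
  \<open>norm (z s) \<le> norm (z s) / 2 + c\<close>, and the rate 1/2 is absorbed on the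
  left.\<close>

lemma small_gronwall:
  fixes z :: "real \<Rightarrow> 'a::real_normed_vector"
  assumes z: "\<And>t. t \<in> {0..1} \<Longrightarrow> (z has_vector_derivative z' t) (at t within {0..1})"
    and b: "\<And>t. t \<in> {0..1} \<Longrightarrow> norm (z' t) \<le> norm (z t) / 2 + c"
    and z0: "z 0 = 0" and t: "t \<in> {0..1}"
  shows "norm (z t) \<le> 2 * c"
proof -
  have "continuous_on {0..1} z"
    using z by (meson has_vector_derivative_continuous continuous_on_eq_continuous_within)
  then obtain s where s: "s \<in> {0..1}" and max: "\<And>t. t \<in> {0..1} \<Longrightarrow> norm (z t) \<le> norm (z s)"
    using continuous_attains_sup[of "{0..1::real}" "\<lambda>t. norm (z t)"] continuous_on_norm
    by fastforce
  define m where "m = norm (z s) / 2 + c"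
  have m: "norm (z' t) \<le> m" if "t \<in> {0..1}" for t
    using b[OF that] max[OF that] by (simp add: m_def)
  have "norm (z s - z 0) \<le> m * norm (s - 0)"
  proof (rule differentiable_bound[of "{0..1}" z "\<lambda>t h. h *\<^sub>R z' t"])
    show "onorm (\<lambda>h. h *\<^sub>R z' t) \<le> m" if "t \<in> {0..1}" for t
      by (rule onorm_le) (use m[OF that] in \<open>simp add: mult.commute[of m] mult_left_mono\<close>)
  qed (use s z in \<open>auto simp: has_vector_derivative_def\<close>)
  also have "\<dots> \<le> m"
    using s m[of 0] norm_ge_zero[of "z' 0"]
    by (simp add: mult_left_le del: norm_ge_zero)
  finally show ?thesis using z0 max[OF t] by (simp add: m_def)
qed

text \<open>Picard iteration that contracts on the whole interval at once: with Lipschitz constant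
  1/2 over unit time the integral operator halves distances, and the bound \<open>R\<close> on the
  speed keeps the solution in the ball.\<close>

lemma small_ode_solution:
  fixes f :: "real \<Rightarrow> 'a::euclidean_space \<Rightarrow> 'a"
  assumes cont: "continuous_on ({0..1} \<times> cball y0 R) (\<lambda>(t, y). f t y)"
    and bound: "\<And>t y. t \<in> {0..1} \<Longrightarrow> y \<in> cball y0 R \<Longrightarrow> norm (f t y) \<le> R"
    and lip: "\<And>t y z. t \<in> {0..1} \<Longrightarrow> y \<in> cball y0 R \<Longrightarrow> z \<in> cball y0 R \<Longrightarrow>
      norm (f t y - f t z) \<le> norm (y - z) / 2"
    and R: "0 \<le> R"
  obtains y where "y 0 = y0" "\<And>t. t \<in> {0..1} \<Longrightarrow> y t \<in> cball y0 R"
    "\<And>t. t \<in> {0..1} \<Longrightarrow> (y has_vector_derivative f t (y t)) (at t within {0..1})"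
proof -
  \<comment> \<open>The nearest-point projection is 1-Lipschitz and makes the right-hand side
    meaningful along arbitrary curves. The fixed point stays in the ball, where \<open>P\<close> is
    the identity, and so solves the original equation.\<close>
  define P where "P = closest_point (cball y0 R)"
  have ne: "cball y0 R \<noteq> {}" using R by auto
  have P: "P y \<in> cball y0 R" for y
    unfolding P_def by (rule closest_point_in_set) (use ne in auto)
  have Plip: "norm (P y - P z) \<le> norm (y - z)" for y z
    unfolding P_def dist_norm[symmetric] by (rule closest_point_lipschitz) (use ne in auto)
  have Pcont: "continuous_on UNIV P"
    unfolding P_def by (rule continuous_on_closest_point) (use ne in auto)
  have P_id: "P y = y" if "y \<in> cball y0 R" for y
    unfolding P_def by (rule closest_point_self[OF that])
  define I where "I y s = integral {0..s} (\<lambda>t. f t (P (y t)))" for y s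
  have gcont: "continuous_on {0..1} (\<lambda>t. f t (P (y t)))" if "continuous_on {0..1} y" for y
  proof -
    have "continuous_on {0..1} (\<lambda>t. (t, P (y t)))"
      using continuous_on_compose2[OF Pcont that] by (intro continuous_on_Pair continuous_on_id) auto
    moreover have "(\<lambda>t. (t, P (y t))) ` {0..1} \<subseteq> {0..1} \<times> cball y0 R" using P by auto
    ultimately show ?thesis using continuous_on_compose2[OF cont] by fastforce
  qed
  have Ider: "((\<lambda>s. I y s) has_vector_derivative f t (P (y t))) (at t within {0..1})"
    if "continuous_on {0..1} y" "t \<in> {0..1}" for y t
    unfolding I_def by (rule integral_has_vector_derivative[OF gcont[OF that(1)] that(2)])
  have gint: "(\<lambda>t. f t (P (y t))) integrable_on {0..s}" if "continuous_on {0..1} y" "s \<in> {0..1}" for y s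
    using that by (intro integrable_continuous_interval continuous_on_subset[OF gcont[OF that(1)]]) auto
  have Ib: "norm (I y s) \<le> R" if "continuous_on {0..1} y" "s \<in> {0..1}" for y s
  proof -
    have "norm (I y s) \<le> integral {0..s} (\<lambda>_. R)"
      unfolding I_def using that by (intro integral_norm_bound_integral gint bound P) auto
    also have "\<dots> \<le> R" using that R by (simp add: mult_left_le_one_le)
    finally show ?thesis .
  qed
  have Ilip: "norm (I y s - I z s) \<le> d / 2"
    if "continuous_on {0..1} y" "continuous_on {0..1} z" "s \<in> {0..1}"
      "\<And>t. norm (y t - z t) \<le> d" for y z s d
  proof -
    have "I y s - I z s = integral {0..s} (\<lambda>t. f t (P (y t)) - f t (P (z t)))"
      unfolding I_def using that by (intro integral_diff[symmetric] gint)
    also have "norm \<dots> \<le> integral {0..s} (\<lambda>_. d / 2)"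
    proof (intro integral_norm_bound_integral integrable_diff gint that)
      fix t assume "t \<in> {0..s}"
      then have "norm (f t (P (y t)) - f t (P (z t))) \<le> norm (P (y t) - P (z t)) / 2"
        using that by (intro lip P) auto
      also have "\<dots> \<le> d / 2" using Plip[of "y t" "z t"] that(4)[of t] by linarith
      finally show "norm (f t (P (y t)) - f t (P (z t))) \<le> d / 2" .
    qed auto
    also have "\<dots> \<le> d / 2" using that(3) order_trans[OF norm_ge_zero that(4)]
      by (simp add: mult_left_le_one_le)
    finally show ?thesis .
  qed
  \<comment> \<open>Clamping time to the unit interval turns the iterates into bounded continuous
    functions on the whole line, which form a complete space.\<close>
  define C where "C t = max 0 (min 1 t)" for t :: real
  have C: "C t \<in> {0..1}" for t by (auto simp: C_def)
  have C_id: "C t = t" if "t \<in> {0..1}" for t using that by (auto simp: C_def)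
  have Ccont: "continuous_on UNIV C" unfolding C_def by (intro continuous_intros)
  have ycont: "continuous_on {0..1} (apply_bcontfun y)" for y :: "real \<Rightarrow>\<^sub>C 'a"
    by simp
  define T where "T y = Bcontfun (\<lambda>t. y0 + I (apply_bcontfun y) (C t))" for y
  have Tin: "(\<lambda>t. y0 + I (apply_bcontfun y) (C t)) \<in> bcontfun" for y
  proof (rule bcontfun_normI)
    have "continuous_on {0..1} (I (apply_bcontfun y))"
      using Ider[OF ycont[of y]]
      by (meson has_vector_derivative_continuous continuous_on_eq_continuous_within)
    then have "continuous_on UNIV (\<lambda>t. I (apply_bcontfun y) (C t))"
      by (rule continuous_on_compose2[OF _ Ccont]) (use C in auto)
    then show "continuous_on UNIV (\<lambda>t. y0 + I (apply_bcontfun y) (C t))"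
      by (intro continuous_intros)
    show "norm (y0 + I (apply_bcontfun y) (C t)) \<le> norm y0 + R" for t
      using Ib[OF ycont[of y] C[of t]] norm_triangle_ineq[of y0 "I (apply_bcontfun y) (C t)"] by linarith
  qed
  have Tapp: "apply_bcontfun (T y) t = y0 + I (apply_bcontfun y) (C t)" for y t
    unfolding T_def by (simp add: Bcontfun_inverse[OF Tin])
  have "dist (T y) (T z) \<le> 1/2 * dist y z" for y z
  proof (rule dist_bound)
    fix t
    have "norm (I (apply_bcontfun y) (C t) - I (apply_bcontfun z) (C t)) \<le> dist y z / 2"
      by (rule Ilip[OF ycont ycont C]) (simp add: dist_bounded flip: dist_norm)
    then show "dist (apply_bcontfun (T y) t) (apply_bcontfun (T z) t) \<le> 1/2 * dist y z"
      by (simp add: Tapp dist_norm)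
  qed
  then obtain y where "T y = y"
    using banach_fix_type[of "1/2" T] by auto
  then have y: "apply_bcontfun y t = y0 + I (apply_bcontfun y) (C t)" for t
    using Tapp[of y t] by simp
  show thesis
  proof (rule that[of "apply_bcontfun y"])
    show "apply_bcontfun y 0 = y0" using y[of 0] by (simp add: C_def I_def)
    show yb: "apply_bcontfun y t \<in> cball y0 R" if "t \<in> {0..1}" for t
      using Ib[OF ycont[of y] C[of t]] by (simp add: y[of t] dist_norm)
    show "(apply_bcontfun y has_vector_derivative f t (apply_bcontfun y t)) (at t within {0..1})"
      if t: "t \<in> {0..1}" for t
    proof (rule has_vector_derivative_transform[OF t])
      show "((\<lambda>s. y0 + I (apply_bcontfun y) s) has_vector_derivative f t (apply_bcontfun y t)) (at t within {0..1})"
        using Ider[OF ycont[of y] t] P_id[OF yb[OF t]]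
        by (auto intro!: derivative_eq_intros)
    qed (metis y C_id)
  qed
qed


text \<open>The operator is assembled from its values on the basis as a finite sum of bounded linear
  images of \<open>l c\<close>. Hence smoothness of \<open>l q c\<close> in \<open>q\<close> for
  each fixed \<open>c\<close> yields smoothness as an operator-valued map.\<close>

definition blinfun_of_basis :: "('a \<Rightarrow> 'b) \<Rightarrow> 'a::euclidean_space \<Rightarrow>\<^sub>L 'b::real_normed_vector" where
  "blinfun_of_basis l = (\<Sum>c\<in>Basis. blinfun_scaleR_left (l c) o\<^sub>L blinfun_inner_left c)"

lemma blinfun_of_basis_apply:
  assumes "linear l"
  shows "blinfun_apply (blinfun_of_basis l) v = l v"
proof -
  interpret linear l by fact
  have "l v = l (\<Sum>c\<in>Basis. (v \<bullet> c) *\<^sub>R c)"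
    by (simp add: euclidean_representation)
  also have "\<dots> = (\<Sum>c\<in>Basis. (v \<bullet> c) *\<^sub>R l c)"
    by (simp only: sum scale)
  finally show ?thesis
    by (simp add: blinfun_of_basis_def blinfun.sum_left inner_commute)
qed

lemma bounded_linear_outer: "bounded_linear (\<lambda>y. blinfun_scaleR_left y o\<^sub>L blinfun_inner_left c)"
  by (intro bounded_linear_intros)

lemma smooth_on_blinfun_of_basis:
  assumes "open S" "\<And>c. smooth_on S (\<lambda>q. l q c)"
  shows "smooth_on S (\<lambda>q. blinfun_of_basis (l q))"
  unfolding blinfun_of_basis_def
  by (intro smooth_on_sum assms smooth_on_bounded_linear[OF bounded_linear_outer])

definition fderiv_blinfun :: "('a::euclidean_space \<Rightarrow> 'b::real_normed_vector) \<Rightarrow> 'a \<Rightarrow> 'a \<Rightarrow>\<^sub>L 'b" where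
  "fderiv_blinfun f q = blinfun_of_basis (\<lambda>c. dderiv c f q)"

lemma fderiv_blinfun_apply:
  "smooth_on U f \<Longrightarrow> q \<in> U \<Longrightarrow> blinfun_apply (fderiv_blinfun f q) v = dderiv v f q"
  unfolding fderiv_blinfun_def by (rule blinfun_of_basis_apply[OF smooth_on_linear_dderiv])

lemma has_derivative_fderiv_blinfun:
  assumes "smooth_on U f" "q \<in> U"
  shows "(f has_derivative blinfun_apply (fderiv_blinfun f q)) (at q)"
  using smooth_on_has_derivative[OF assms] fderiv_blinfun_apply[OF assms] by presburger

lemma continuous_on_fderiv_blinfun:
  assumes "smooth_on U f"
  shows "continuous_on U (fderiv_blinfun f)"
  unfolding fderiv_blinfun_def blinfun_of_basis_def
  by (intro continuous_on_sum bounded_linear.continuous_on[OF bounded_linear_outer]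
      smooth_on_continuous_on smooth_on_dderiv assms)

section \<open>The Frobenius theorem for graphs\<close>

text \<open>
  The solution is obtained by integrating along the rays from \<open>x0\<close>; the compatibility condition
  makes its derivative transversal to the ray agree with \<open>A\<close> as well.
\<close>

lemma frobenius_graph:
  fixes A :: "'x::euclidean_space \<times> 'y::euclidean_space \<Rightarrow> 'x \<Rightarrow>\<^sub>L 'y"
  assumes U: "open U" "(x0, y0) \<in> U" and A: "smooth_on U A"
    and compat: "\<And>q h k. q \<in> U \<Longrightarrow>
      blinfun_apply (dderiv (h, blinfun_apply (A q) h) A q) k =
      blinfun_apply (dderiv (k, blinfun_apply (A q) k) A q) h"
  obtains r s where "0 < r" "s x0 = y0"
    "\<And>x. x \<in> ball x0 r \<Longrightarrow> (x, s x) \<in> U"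
    "\<And>x. x \<in> ball x0 r \<Longrightarrow> (s has_derivative blinfun_apply (A (x, s x))) (at x)"
proof -
  define A' where "A' = fderiv_blinfun A"
  have der: "(A has_derivative blinfun_apply (A' q)) (at q)" if "q \<in> U" for q
    unfolding A'_def by (rule has_derivative_fderiv_blinfun[OF A that])
  \<comment> \<open>For a solution of Ds = A(x, s), the left side is the second derivative of s in
    the directions \<open>h\<close> and \<open>k\<close>; the condition expresses its
    symmetry.\<close>
  have compat': "blinfun_apply (A' q (h, A q h)) k = blinfun_apply (A' q (k, A q k)) h"
    if "q \<in> U" for q h k
    unfolding A'_def fderiv_blinfun_apply[OF A that] by (rule compat[OF that])
  obtain e0 where e0: "0 < e0" "cball (x0, y0) e0 \<subseteq> U" using U open_contains_cball by blast
  \<comment> \<open>Half the radius in each factor suffices, since the distance in the product is at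
    most the sum of the two component distances.\<close>
  define R where "R = e0 / 2"
  have R: "0 < R" using e0 by (simp add: R_def)
  define K where "K = cball x0 R \<times> cball y0 R"
  have K_sub: "K \<subseteq> U"
  proof
    fix q assume q: "q \<in> K"
    have "dist (x0, y0) q \<le> dist x0 (fst q) + dist y0 (snd q)"
      unfolding dist_prod_def by (rule order_trans[OF sqrt_sum_squares_le_sum]) auto
    with q have "q \<in> cball (x0, y0) e0" by (auto simp: K_def R_def)
    then show "q \<in> U" using e0 by blast
  qed
  have K: "compact K" "convex K"
    unfolding K_def by (auto intro: compact_Times convex_Times)
  have cA: "continuous_on K A" and cA': "continuous_on K A'"
    using continuous_on_subset[OF smooth_on_continuous_on[OF A] K_sub]
      continuous_on_subset[OF continuous_on_fderiv_blinfun[OF A] K_sub] by (simp_all add: A'_def)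
  obtain M where M: "0 < M" "\<And>q. q \<in> K \<Longrightarrow> norm (A q) \<le> M"
    using compact_imp_bounded[OF compact_continuous_image[OF cA K(1)]] by (auto simp: bounded_pos)
  obtain L where L: "0 < L" "\<And>q. q \<in> K \<Longrightarrow> norm (A' q) \<le> L"
    using compact_imp_bounded[OF compact_continuous_image[OF cA' K(1)]] by (auto simp: bounded_pos)
  have lip: "norm (A p - A q) \<le> L * norm (p - q)" if "p \<in> K" "q \<in> K" for p q
  proof (rule differentiable_bound[OF K(2) _ _ that])
    show "(A has_derivative blinfun_apply (A' x)) (at x within K)" if "x \<in> K" for x
      using der K_sub that has_derivative_at_withinI by blast
    show "onorm (blinfun_apply (A' x)) \<le> L" if "x \<in> K" for x
      using L(2)[OF that] by (simp add: norm_blinfun.rep_eq)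
  qed
  \<comment> \<open>The three bounds keep \<open>x\<close> within \<open>R\<close> of
    \<open>x0\<close>, keep solutions within \<open>R\<close> of \<open>y0\<close> because their
    speed is at most \<open>M * r\<close>, and bring the Lipschitz constant along a ray down to
    1/2.\<close>
  define r where "r = Min {R, R / M, 1 / (2 * L)}"
  have r: "0 < r" "r \<le> R" "M * r \<le> R" "L * r \<le> 1 / 2"
  proof -
    show "0 < r" using R M L by (simp add: r_def)
    have "r \<le> R / M" "r \<le> 1 / (2 * L)" by (auto simp: r_def)
    then show "M * r \<le> R" "L * r \<le> 1 / 2" using M L by (auto simp: field_simps)
  qed (simp add: r_def)
  have inx: "x0 + t *\<^sub>R h \<in> cball x0 R" if "norm h \<le> r" "t \<in> {0..1}" for t h
  proof -
    have "\<bar>t\<bar> * norm h \<le> 1 * r" using that by (intro mult_mono) auto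
    then show ?thesis using r by (simp add: dist_norm)
  qed
  \<comment> \<open>Every ray is run through in unit time, so the length of \<open>h\<close> takes
    the role of the time span and its smallness provides the contraction.\<close>
  have "\<exists>y. y 0 = y0 \<and> (\<forall>t\<in>{0..1}. y t \<in> cball y0 R \<and>
      (y has_vector_derivative A (x0 + t *\<^sub>R h, y t) h) (at t within {0..1}))"
    if h: "norm h \<le> r" for h
  proof (rule small_ode_solution[of y0 R "\<lambda>t y. A (x0 + t *\<^sub>R h, y) h"])
    have "continuous_on ({0..1} \<times> cball y0 R) (\<lambda>p. A (x0 + fst p *\<^sub>R h, snd p))"
    proof (rule continuous_on_compose2[OF cA])
      show "continuous_on ({0..1} \<times> cball y0 R) (\<lambda>p. (x0 + fst p *\<^sub>R h, snd p))"
        by (intro continuous_intros)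
    qed (use inx[OF h] in \<open>auto simp: K_def\<close>)
    then have "continuous_on ({0..1} \<times> cball y0 R) (\<lambda>p. blinfun_apply (A (x0 + fst p *\<^sub>R h, snd p)) h)"
      by (intro continuous_intros)
    then show "continuous_on ({0..1} \<times> cball y0 R) (\<lambda>(t, y). blinfun_apply (A (x0 + t *\<^sub>R h, y)) h)"
      by (simp add: case_prod_beta)
    show "norm (A (x0 + t *\<^sub>R h, y) h) \<le> R" if "t \<in> {0..1}" "y \<in> cball y0 R" for t y
    proof -
      have "norm (A (x0 + t *\<^sub>R h, y) h) \<le> norm (A (x0 + t *\<^sub>R h, y)) * norm h" by (rule norm_blinfun)
      also have "\<dots> \<le> M * r"
        using that inx[OF h] h M by (intro mult_mono) (auto simp: K_def)
      finally show ?thesis using r by linarith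
    qed
    show "norm (A (x0 + t *\<^sub>R h, y) h - A (x0 + t *\<^sub>R h, z) h) \<le> norm (y - z) / 2"
      if "t \<in> {0..1}" "y \<in> cball y0 R" "z \<in> cball y0 R" for t y z
    proof -
      have "norm (A (x0 + t *\<^sub>R h, y) h - A (x0 + t *\<^sub>R h, z) h) \<le>
          norm (A (x0 + t *\<^sub>R h, y) - A (x0 + t *\<^sub>R h, z)) * norm h"
        by (metis blinfun.diff_left norm_blinfun)
      also have "\<dots> \<le> (L * norm (y - z)) * r"
        using that inx[OF h] h L lip[of "(x0 + t *\<^sub>R h, y)" "(x0 + t *\<^sub>R h, z)"]
        by (intro mult_mono) (auto simp: K_def)
      also have "\<dots> = (L * r) * norm (y - z)" by simp
      also have "\<dots> \<le> 1 / 2 * norm (y - z)" using r by (intro mult_right_mono) auto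
      finally show ?thesis by simp
    qed
  qed (use R in auto)
  then obtain Y where Y0: "\<And>h. norm h \<le> r \<Longrightarrow> Y h 0 = y0"
    and YR: "\<And>h t. norm h \<le> r \<Longrightarrow> t \<in> {0..1} \<Longrightarrow> Y h t \<in> cball y0 R"
    and Yd: "\<And>h t. norm h \<le> r \<Longrightarrow> t \<in> {0..1} \<Longrightarrow>
      (Y h has_vector_derivative A (x0 + t *\<^sub>R h, Y h t) h) (at t within {0..1})"
    by metis
  define s where "s x = Y (x - x0) 1" for x
  have inK: "(x0 + t *\<^sub>R h, Y h t) \<in> K" if "norm h \<le> r" "t \<in> {0..1}" for h t
    using inx[OF that] YR[OF that] by (simp add: K_def)
  show thesis
  proof (rule that)
    show "0 < r" by fact
    have "norm (Y 0 1 - y0) \<le> 2 * 0"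
    proof (rule small_gronwall[of "\<lambda>t. Y 0 t - y0" "\<lambda>t. 0"])
      show "((\<lambda>t. Y 0 t - y0) has_vector_derivative 0) (at t within {0..1})" if "t \<in> {0..1}" for t
        using Yd[of 0 t] r that by (auto intro!: derivative_eq_intros)
    qed (use Y0[of 0] r in auto)
    then show "s x0 = y0" by (simp add: s_def)
    show "(x, s x) \<in> U" if "x \<in> ball x0 r" for x
      using inK[of "x - x0" 1] K_sub that by (auto simp: s_def dist_norm norm_minus_commute)
    fix x assume x: "x \<in> ball x0 r"
    define h where "h = x - x0"
    have hr: "norm h < r" using x by (simp add: h_def dist_norm norm_minus_commute)
    \<comment> \<open>\<open>c * norm k\<close> will bound the distance between neighbouring
      solutions: \<open>norm k\<close> comes from the rays, \<open>(1 + 2 * M) * norm k\<close> from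
      the Gronwall estimate for their difference.\<close>
    define c where "c = 2 + 2 * M"
    have c: "0 < c" using M by (simp add: c_def)
    show "(s has_derivative A (x, s x)) (at x)"
      unfolding has_derivative_at_alt
    proof (intro conjI allI impI)
      show "bounded_linear (blinfun_apply (A (x, s x)))" by (rule blinfun.bounded_linear_right)
      fix e :: real assume e: "0 < e"
      \<comment> \<open>\<open>\<epsilon>\<close> and the last bound in \<open>d\<close> are tuned
        so that each of the two parts of the final error \<open>2 * C\<close> is at most half of
        \<open>e * norm k\<close>.\<close>
      define \<epsilon> where "\<epsilon> = e / (4 * r * c)"
      have \<epsilon>: "0 < \<epsilon>" using e r c by (simp add: \<epsilon>_def)
      obtain d0 where d0: "0 < d0"
        "\<And>p q. p \<in> K \<Longrightarrow> q \<in> K \<Longrightarrow> dist p q < d0 \<Longrightarrow> dist (A' p) (A' q) < \<epsilon>"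
        using compact_uniformly_continuous[OF cA' K(1)] \<epsilon> unfolding uniformly_continuous_on_def
        by metis
      define d where "d = Min {r - norm h, d0 / c, e / (4 * L * c)}"
      have d: "0 < d" using hr d0 c e L by (simp add: d_def)
      show "\<exists>d>0. \<forall>y. norm (y - x) < d \<longrightarrow> norm (s y - s x - A (x, s x) (y - x)) \<le> e * norm (y - x)"
      proof (intro exI[of _ d] conjI allI impI d)
        fix x' assume x': "norm (x' - x) < d"
        define k where "k = x' - x"
        have kd: "norm k < r - norm h" "norm k < d0 / c" "norm k < e / (4 * L * c)"
          using x' by (auto simp: k_def d_def)
        then have k1: "c * norm k < d0" "L * norm k \<le> e / (4 * c)"
          using c L by (auto simp: field_simps)
        have hk: "norm (h + k) \<le> r" "norm h \<le> r"
          using norm_triangle_ineq[of h k] kd(1) hr by linarith+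
        define p where "p t = (x0 + t *\<^sub>R (h + k), Y (h + k) t)" for t
        define q where "q t = (x0 + t *\<^sub>R h, Y h t)" for t
        have pK: "p t \<in> K" and qK: "q t \<in> K" if "t \<in> {0..1}" for t
          using inK[OF hk(1) that] inK[OF hk(2) that] by (simp_all add: p_def q_def)
        define \<Delta> where "\<Delta> t = Y (h + k) t - Y h t" for t
        have pq: "p t - q t = (t *\<^sub>R k, \<Delta> t)" for t
          by (simp add: p_def q_def \<Delta>_def scaleR_add_right)
        have npq: "norm (p t - q t) \<le> norm k + norm (\<Delta> t)" if "t \<in> {0..1}" for t
        proof -
          have "norm (p t - q t) \<le> norm (t *\<^sub>R k) + norm (\<Delta> t)" unfolding pq by (rule norm_Pair_le)
          also have "norm (t *\<^sub>R k) \<le> norm k" using that by (simp add: mult_left_le_one_le)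
          finally show ?thesis by simp
        qed
        have \<Delta>d: "(\<Delta> has_vector_derivative A (p t) (h + k) - A (q t) h) (at t within {0..1})"
          if "t \<in> {0..1}" for t
          unfolding \<Delta>_def p_def q_def using that by (intro has_vector_derivative_diff Yd hk)
        have Lr: "L * a * norm h \<le> a / 2" if "0 \<le> a" for a
        proof -
          have "L * a * norm h \<le> L * a * r" using hk that L by (intro mult_left_mono) auto
          also have "\<dots> = (L * r) * a" by simp
          also have "\<dots> \<le> 1 / 2 * a" using r that by (intro mult_right_mono) auto
          finally show ?thesis by simp
        qed
        have n\<Delta>: "norm (\<Delta> t) \<le> 2 * ((1 / 2 + M) * norm k)" if "t \<in> {0..1}" for t
        proof (rule small_gronwall[OF \<Delta>d _ _ that])
          fix t :: real assume t: "t \<in> {0..1}"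
          have "A (p t) (h + k) - A (q t) h = (A (p t) - A (q t)) h + A (p t) k"
            by (simp add: blinfun.diff_left blinfun.add_right)
          also have "norm \<dots> \<le> norm (A (p t) - A (q t)) * norm h + norm (A (p t)) * norm k"
            by (intro norm_triangle_le add_mono norm_blinfun)
          also have "\<dots> \<le> (L * (norm k + norm (\<Delta> t))) * norm h + M * norm k"
            using order_trans[OF lip[OF pK[OF t] qK[OF t]] mult_left_mono[OF npq[OF t]]] L M(2)[OF pK[OF t]]
            by (intro add_mono mult_right_mono) auto
          also have "\<dots> \<le> (norm k + norm (\<Delta> t)) / 2 + M * norm k"
            by (intro add_right_mono Lr) auto
          also have "\<dots> = norm (\<Delta> t) / 2 + (1 / 2 + M) * norm k"
            by (simp add: algebra_simps add_divide_distrib)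
          finally show "norm (A (p t) (h + k) - A (q t) h) \<le> norm (\<Delta> t) / 2 + (1 / 2 + M) * norm k" .
        qed (use Y0 hk in \<open>auto simp: \<Delta>_def\<close>)
        have npq': "norm (p t - q t) \<le> c * norm k" if "t \<in> {0..1}" for t
          using npq[OF that] n\<Delta>[OF that] by (simp add: c_def algebra_simps)
        \<comment> \<open>First-order expansion of \<open>A\<close> on a convex piece of
          \<open>K\<close> around \<open>q t\<close>, on which uniform continuity keeps
          \<open>A'\<close> within \<open>\<epsilon>\<close> of its value at
          \<open>q t\<close>.\<close>
        have lin: "norm (A (p t) - A (q t) - A' (q t) (p t - q t)) \<le> norm (p t - q t) * \<epsilon>"
          if t: "t \<in> {0..1}" for t
        proof (rule differentiable_bound_linearization[where S = "K \<inter> cball (q t) (c * norm k)" and f' = "\<lambda>q. blinfun_apply (A' q)"])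
          have "convex (K \<inter> cball (q t) (c * norm k))" using K(2) by (intro convex_Int) auto
          moreover have "q t \<in> K \<inter> cball (q t) (c * norm k)" "p t \<in> K \<inter> cball (q t) (c * norm k)"
            using pK[OF t] qK[OF t] npq'[OF t] c by (auto simp: dist_norm norm_minus_commute)
          ultimately show "q t + u *\<^sub>R (p t - q t) \<in> K \<inter> cball (q t) (c * norm k)" if "u \<in> {0..1}" for u
            using that convexD_alt[of "K \<inter> cball (q t) (c * norm k)" "q t" "p t" u]
            by (simp add: algebra_simps)
          show "q t \<in> K \<inter> cball (q t) (c * norm k)" by fact
          fix z assume z: "z \<in> K \<inter> cball (q t) (c * norm k)"
          then show "(A has_derivative blinfun_apply (A' z)) (at z within K \<inter> cball (q t) (c * norm k))"
            using der K_sub has_derivative_at_withinI by blast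
          have "norm (A' z - A' (q t)) < \<epsilon>"
            using d0(2)[of z "q t"] z k1 qK[OF t] by (auto simp: dist_norm norm_minus_commute)
          moreover have "blinfun_apply (A' z) - blinfun_apply (A' (q t)) = blinfun_apply (A' z - A' (q t))"
            by (auto simp: blinfun.diff_left)
          ultimately show "onorm (blinfun_apply (A' z) - blinfun_apply (A' (q t))) \<le> \<epsilon>"
            by (simp add: norm_blinfun.rep_eq)
        qed
        \<comment> \<open>At \<open>t = 1\<close> this is the linearisation error of
          \<open>s\<close>. The factor \<open>t\<close> is there because changing \<open>h\<close>
          by \<open>k\<close> moves the point of the ray at time \<open>t\<close> by
          \<open>t *\<^sub>R k\<close>.\<close>
        define w where "w t = \<Delta> t - t *\<^sub>R A (q t) k" for t
        define w' where "w' t = A (p t) (h + k) - A (q t) h - (A (q t) k + t *\<^sub>R A' (q t) (h, A (q t) h) k)" for t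
        have wd: "(w has_vector_derivative w' t) (at t within {0..1})" if t: "t \<in> {0..1}" for t
        proof -
          have "(q has_vector_derivative (h, A (q t) h)) (at t within {0..1})"
            unfolding q_def
            by (intro has_vector_derivative_Pair Yd[OF hk(2) t]) (auto intro!: derivative_eq_intros)
          then have "((\<lambda>t. A (q t)) has_derivative (\<lambda>u. A' (q t) (u *\<^sub>R (h, A (q t) h)))) (at t within {0..1})"
            unfolding has_vector_derivative_def
            by (rule has_derivative_compose) (use der qK[OF t] K_sub in blast)
          from bounded_linear.has_derivative[OF blinfun.bounded_linear_left this, of k]
          have "((\<lambda>t. A (q t) k) has_vector_derivative A' (q t) (h, A (q t) h) k) (at t within {0..1})"
            by (simp only: has_vector_derivative_def blinfun.scaleR_right blinfun.scaleR_left)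
          then have "((\<lambda>t. t *\<^sub>R A (q t) k) has_vector_derivative
              (A (q t) k + t *\<^sub>R A' (q t) (h, A (q t) h) k)) (at t within {0..1})"
            by (auto intro!: derivative_eq_intros)
          then show ?thesis
            unfolding w_def w'_def by (intro has_vector_derivative_diff \<Delta>d t)
        qed
        define C where "C = c * norm k * (\<epsilon> * r + L * norm k)"
        have "norm (w 1) \<le> 2 * C"
        proof (rule small_gronwall[OF wd])
          fix t :: real assume t: "t \<in> {0..1}"
          have qU: "q t \<in> U" using qK[OF t] K_sub by blast
          \<comment> \<open>Here compatibility enters: it exchanges \<open>h\<close> and
            \<open>k\<close>, and \<open>t *\<^sub>R (k, A (q t) k)\<close> is the displacement
            \<open>p t - q t\<close> up to \<open>(0, w t)\<close>. So \<open>w'\<close> reduces to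
            a Taylor remainder, a term linear in \<open>w\<close>, and a product of two factors of
            size \<open>norm k\<close>.\<close>
          have "t *\<^sub>R A' (q t) (h, A (q t) h) k = A' (q t) (t *\<^sub>R (k, A (q t) k)) h"
            by (simp only: compat'[OF qU, of h k] blinfun.scaleR_right blinfun.scaleR_left)
          also have "t *\<^sub>R (k, A (q t) k) = (p t - q t) - (0, w t)"
            by (simp add: pq w_def)
          finally have "t *\<^sub>R A' (q t) (h, A (q t) h) k = A' (q t) (p t - q t) h - A' (q t) (0, w t) h"
            by (simp only: blinfun.diff_right blinfun.diff_left)
          then have "w' t = (A (p t) - A (q t) - A' (q t) (p t - q t)) h + A' (q t) (0, w t) h + (A (p t) - A (q t)) k"
            unfolding w'_def by (simp add: blinfun.add_right blinfun.add_left blinfun.diff_left algebra_simps)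
          also have "norm \<dots> \<le> norm (A (p t) - A (q t) - A' (q t) (p t - q t)) * norm h
              + (norm (A' (q t)) * norm (w t)) * norm h + norm (A (p t) - A (q t)) * norm k"
          proof (intro norm_triangle_le add_mono norm_blinfun)
            have "norm (A' (q t) (0, w t)) \<le> norm (A' (q t)) * norm (w t)"
              using norm_blinfun[of "A' (q t)" "(0, w t)"] by simp
            then show "norm (A' (q t) (0, w t) h) \<le> norm (A' (q t)) * norm (w t) * norm h"
              by (rule order_trans[OF norm_blinfun mult_right_mono]) simp
          qed
          also have "\<dots> \<le> (c * norm k * \<epsilon>) * r + (L * norm (w t)) * norm h + (L * (c * norm k)) * norm k"
          proof (intro add_mono)
            have "norm (A (p t) - A (q t) - A' (q t) (p t - q t)) \<le> c * norm k * \<epsilon>"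
              using lin[OF t] mult_right_mono[OF npq'[OF t], of \<epsilon>] \<epsilon> by linarith
            then show "norm (A (p t) - A (q t) - A' (q t) (p t - q t)) * norm h \<le> (c * norm k * \<epsilon>) * r"
              using hk \<epsilon> c by (intro mult_mono) auto
            show "norm (A' (q t)) * norm (w t) * norm h \<le> L * norm (w t) * norm h"
              using L(2)[OF qK[OF t]] by (intro mult_right_mono) auto
            show "norm (A (p t) - A (q t)) * norm k \<le> L * (c * norm k) * norm k"
              using order_trans[OF lip[OF pK[OF t] qK[OF t]] mult_left_mono[OF npq'[OF t]]] L
              by (intro mult_right_mono) auto
          qed
          also have "\<dots> \<le> norm (w t) / 2 + C"
            using Lr[of "norm (w t)"] by (simp add: C_def algebra_simps)
          finally show "norm (w' t) \<le> norm (w t) / 2 + C" .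
        qed (use Y0 hk in \<open>auto simp: w_def \<Delta>_def\<close>)
        also have "2 * C \<le> e * norm k"
        proof -
          have "\<epsilon> * r + L * norm k \<le> e / (4 * c) + e / (4 * c)"
            using k1(2) r by (intro add_mono) (simp_all add: \<epsilon>_def)
          then have "c * norm k * (\<epsilon> * r + L * norm k) \<le> c * norm k * (e / (4 * c) + e / (4 * c))"
            using c by (intro mult_left_mono) auto
          also have "\<dots> = e * norm k / 2" using c by (simp add: field_simps)
          finally show ?thesis by (simp add: C_def)
        qed
        also have "w 1 = s x' - s x - A (x, s x) (x' - x)"
          by (simp add: w_def \<Delta>_def s_def q_def h_def k_def)
        finally show "norm (s x' - s x - A (x, s x) (x' - x)) \<le> e * norm (x' - x)"
          by (simp add: k_def)
      qed
    qed
  qed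
qed

section \<open>The connection of a spray\<close>

lemma smooth_on_fderiv_blinfun: "open S \<Longrightarrow> smooth_on S f \<Longrightarrow> smooth_on S (fderiv_blinfun f)"
  unfolding fderiv_blinfun_def by (intro smooth_on_blinfun_of_basis smooth_on_dderiv)

text \<open>Point and direction both vary with \<open>w\<close>. Written as the operator
  \<open>fderiv_blinfun f (P w)\<close> applied to \<open>e w\<close>, the expression falls under
  the product rule for the bilinear application map.\<close>

lemma has_derivative_dderiv_along:
  fixes f :: "'a::euclidean_space \<Rightarrow> 'b::real_normed_vector"
  assumes S: "open S" "smooth_on S f" and P: "(P has_derivative P') (at w)" "P w \<in> S"
    and e: "(e has_derivative e') (at w)"
  shows "((\<lambda>w. dderiv (e w) f (P w)) has_derivative
    (\<lambda>h. dderiv (P' h) (dderiv (e w) f) (P w) + dderiv (e' h) f (P w))) (at w)"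
proof -
  let ?b = "fderiv_blinfun f"
  have b: "(?b has_derivative (\<lambda>h. dderiv h ?b (P w))) (at (P w))"
    by (rule smooth_on_has_derivative[OF smooth_on_fderiv_blinfun[OF S] P(2)])
  have "((\<lambda>w. ?b (P w)) has_derivative (\<lambda>h. dderiv (P' h) ?b (P w))) (at w)"
    using diff_chain_at[OF P(1) b] by (simp add: o_def)
  from bounded_bilinear.FDERIV[OF bounded_bilinear_blinfun_apply this e]
  have "((\<lambda>w. blinfun_apply (?b (P w)) (e w)) has_derivative
    (\<lambda>h. blinfun_apply (?b (P w)) (e' h) + blinfun_apply (dderiv (P' h) ?b (P w)) (e w))) (at w)" .
  also have "(\<lambda>h. blinfun_apply (?b (P w)) (e' h) + blinfun_apply (dderiv (P' h) ?b (P w)) (e w)) =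
    (\<lambda>h. dderiv (P' h) (dderiv (e w) f) (P w) + dderiv (e' h) f (P w))"
  proof
    fix h
    have "dderiv (P' h) (dderiv (e w) f) (P w) = dderiv (P' h) (\<lambda>p. blinfun_apply (?b p) (e w)) (P w)"
      by (rule dderiv_cong[OF S(1) _ P(2)]) (simp add: fderiv_blinfun_apply[OF S(2)])
    also have "\<dots> = blinfun_apply (dderiv (P' h) ?b (P w)) (e w)"
      by (rule dderivI[OF bounded_linear.has_derivative[OF blinfun.bounded_linear_left b]])
    finally show "blinfun_apply (?b (P w)) (e' h) + blinfun_apply (dderiv (P' h) ?b (P w)) (e w) =
      dderiv (P' h) (dderiv (e w) f) (P w) + dderiv (e' h) f (P w)"
      by (simp add: fderiv_blinfun_apply[OF S(2) P(2)])
  qed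
  finally show ?thesis
  proof (rule has_derivative_transform_eventually)
    \<comment> \<open>The operator form agrees with \<open>dderiv\<close> over \<open>S\<close>,
      where \<open>P\<close> remains near \<open>w\<close> by continuity.\<close>
    have "\<forall>\<^sub>F v in at w. P v \<in> S"
      using has_derivative_continuous[OF P(1)] S(1) P(2)
      by (auto simp: continuous_at topological_tendstoD isCont_def)
    then show "\<forall>\<^sub>F v in at w. blinfun_apply (?b (P v)) (e v) = dderiv (e v) f (P v)"
      by eventually_elim (simp add: fderiv_blinfun_apply[OF S(2)])
    show "blinfun_apply (?b (P w)) (e w) = dderiv (e w) f (P w)"
      by (simp add: fderiv_blinfun_apply[OF S(2) P(2)])
  qed simp
qed

lemma dderiv_bounded_linear:
  assumes "bounded_linear l" "f differentiable at p"
  shows "dderiv v (\<lambda>x. l (f x)) p = l (dderiv v f p)"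
  by (rule dderivI[OF bounded_linear.has_derivative[OF assms(1) has_derivative_dderiv[OF assms(2)]]])

lemma dderiv_diff:
  "f differentiable at p \<Longrightarrow> g differentiable at p \<Longrightarrow> dderiv v (\<lambda>x. f x - g x) p = dderiv v f p - dderiv v g p"
  by (rule dderivI[OF has_derivative_diff]) (auto intro: has_derivative_dderiv)

section \<open>The nonlinear connection and its curvature\<close>

text \<open>
  \<open>H\<close> and \<open>V\<close> embed the base and the fibre directions of a trivialised tangent bundle;
  \<open>\<pi>\<close> and \<open>\<kappa>\<close> are the corresponding projections.
\<close>

locale spray =
  fixes H V :: "'b::euclidean_space \<Rightarrow> 'q::euclidean_space" and \<pi> \<kappa> :: "'q \<Rightarrow> 'b"
    and D :: "'q set" and B :: "'q \<Rightarrow> 'b"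
  assumes bounded_linears: "bounded_linear H" "bounded_linear V" "bounded_linear \<pi>" "bounded_linear \<kappa>"
    and projections [simp]: "\<pi> (H a) = a" "\<pi> (V a) = 0" "\<kappa> (H a) = 0" "\<kappa> (V a) = a"
    and split: "H (\<pi> w) + V (\<kappa> w) = w"
    and open_D: "open D" and smooth_B: "smooth_on D B"
begin

lemmas linears = bounded_linears[THEN bounded_linear.linear]
lemmas map_simps =
  linears(1)[THEN linear_add] linears(1)[THEN linear_diff] linears(1)[THEN linear_neg] linears(1)[THEN linear_0]
  linears(2)[THEN linear_add] linears(2)[THEN linear_diff] linears(2)[THEN linear_neg] linears(2)[THEN linear_0]
  linears(3)[THEN linear_add] linears(3)[THEN linear_diff] linears(3)[THEN linear_neg] linears(3)[THEN linear_0]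
  linears(4)[THEN linear_add] linears(4)[THEN linear_diff] linears(4)[THEN linear_neg] linears(4)[THEN linear_0]

definition N :: "'q \<Rightarrow> 'b \<Rightarrow> 'b" where "N q e = dderiv (V e) B q"
definition hlift :: "'q \<Rightarrow> 'b \<Rightarrow> 'q" where "hlift q e = H e - V (N q e)"
text \<open>The connection form; in the warped product its components are
  \<open>delta_y_form\<close> and \<open>delta_v_form\<close>. Together with \<open>\<pi>\<close> it
  gives the coordinates of a vector in the adapted frame.\<close>

definition vert :: "'q \<Rightarrow> 'q \<Rightarrow> 'b" where "vert q w = \<kappa> w + N q (\<pi> w)"
definition J :: "'q \<Rightarrow> 'q \<Rightarrow> 'q" where "J q w = hlift q (vert q w) - V (\<pi> w)"
definition DN :: "'q \<Rightarrow> 'q \<Rightarrow> 'b \<Rightarrow> 'b" where "DN q Z e = dderiv Z (\<lambda>p. N p e) q"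
text \<open>For constant \<open>a\<close> and \<open>b\<close> the Lie bracket of the fields
  \<open>hlift _ a\<close> and \<open>hlift _ b\<close> at \<open>q\<close> is the vertical vector
  \<open>- V (curv q a b)\<close>.\<close>

definition curv :: "'q \<Rightarrow> 'b \<Rightarrow> 'b \<Rightarrow> 'b" where
  "curv q a b = DN q (hlift q a) b - DN q (hlift q b) a"

lemma smooth_N: "smooth_on D (\<lambda>q. N q e)"
  unfolding N_def by (rule smooth_on_dderiv[OF smooth_B])

lemma linear_N: "q \<in> D \<Longrightarrow> linear (N q)"
  using linear_compose[OF linears(2) smooth_on_linear_dderiv[OF smooth_B]]
  by (simp add: N_def[abs_def] o_def)

lemma N_simps:
  assumes "q \<in> D"
  shows "N q (a + b) = N q a + N q b" "N q (a - b) = N q a - N q b" "N q (- a) = - N q a" "N q 0 = 0"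
    "N q (c *\<^sub>R a) = c *\<^sub>R N q a"
  using linear_N[OF assms] by (simp_all add: linear_add linear_diff linear_neg linear_0 linear_scale)

lemma hlift_simps:
  assumes "q \<in> D"
  shows "hlift q (a + b) = hlift q a + hlift q b" "hlift q (a - b) = hlift q a - hlift q b"
    "hlift q (- a) = - hlift q a" "hlift q 0 = 0"
  by (simp_all add: hlift_def N_simps[OF assms] map_simps)

lemma linear_hlift: "q \<in> D \<Longrightarrow> linear (hlift q)"
  by (rule linearI) (simp_all add: hlift_def N_simps map_simps linears[THEN linear_scale] scaleR_diff_right)

lemma vert_simps:
  assumes "q \<in> D"
  shows "vert q (a + b) = vert q a + vert q b" "vert q (a - b) = vert q a - vert q b"
    "vert q (- a) = - vert q a"
  by (simp_all add: vert_def N_simps[OF assms] map_simps)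

lemma frame_simps:
  assumes "q \<in> D"
  shows "vert q (hlift q a) = 0" "vert q (V a) = a" "\<pi> (hlift q a) = a"
  by (simp_all add: vert_def hlift_def map_simps N_simps[OF assms])

lemma frame_decomp: "hlift q (\<pi> w) + V (vert q w) = w"
  using split[of w] by (simp add: hlift_def vert_def map_simps)

lemma J_simps:
  assumes "q \<in> D"
  shows "J q (a + b) = J q a + J q b" "J q (a - b) = J q a - J q b" "J q (- a) = - J q a"
  by (simp_all add: J_def vert_simps[OF assms] hlift_simps[OF assms] map_simps)

lemma J_frame:
  assumes "q \<in> D"
  shows "\<pi> (J q w) = vert q w" "vert q (J q w) = - \<pi> w" "J q (J q w) = - w"
    "J q (hlift q a) = - V a" "J q (V a) = hlift q a"
proof -
  show *: "\<pi> (J q w) = vert q w" "vert q (J q w) = - \<pi> w"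
    by (simp_all add: J_def vert_simps[OF assms] frame_simps[OF assms] map_simps)
  have "J q (J q w) = - (hlift q (\<pi> w) + V (vert q w))"
    by (subst J_def) (simp add: * hlift_simps[OF assms])
  then show "J q (J q w) = - w" by (simp add: frame_decomp)
qed (simp_all add: J_def frame_simps[OF assms] hlift_simps[OF assms] map_simps)

lemma linear_DN: "q \<in> D \<Longrightarrow> linear (\<lambda>Z. DN q Z e)"
  unfolding DN_def by (rule smooth_on_linear_dderiv[OF smooth_N])

lemma DN_simps:
  assumes q: "q \<in> D"
  shows "DN q (Y + Z) e = DN q Y e + DN q Z e" "DN q (Y - Z) e = DN q Y e - DN q Z e"
    "DN q (- Z) e = - DN q Z e" "DN q 0 e = 0" "DN q Z 0 = 0"
proof -
  show "DN q (Y + Z) e = DN q Y e + DN q Z e" "DN q (Y - Z) e = DN q Y e - DN q Z e"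
    "DN q (- Z) e = - DN q Z e" "DN q 0 e = 0"
    by (fact linear_add[OF linear_DN[OF q]] linear_diff[OF linear_DN[OF q]]
        linear_neg[OF linear_DN[OF q]] linear_0[OF linear_DN[OF q]])+
  have "DN q Z 0 = dderiv Z (\<lambda>p. 0) q"
    unfolding DN_def by (rule dderiv_cong[OF open_D _ q]) (simp add: N_simps)
  then show "DN q Z 0 = 0" by (simp add: dderiv_def)
qed

lemma DN_eq: "DN q Z e = dderiv Z (dderiv (V e) B) q"
  by (simp add: DN_def N_def[abs_def])

lemma DN_vertical_commute: "q \<in> D \<Longrightarrow> DN q (V a) b = DN q (V b) a"
  unfolding DN_eq by (rule dderiv_commute[OF open_D smooth_B])

section \<open>The Nijenhuis tensor\<close>

lemma has_derivative_N:
  assumes "(P has_derivative P') (at w)" "P w \<in> D" "(e has_derivative e') (at w)"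
  shows "((\<lambda>w. N (P w) (e w)) has_derivative (\<lambda>h. DN (P w) (P' h) (e w) + N (P w) (e' h))) (at w)"
  unfolding DN_eq N_def
  by (rule has_derivative_dderiv_along[OF open_D smooth_B assms(1,2)])
    (rule bounded_linear.has_derivative[OF bounded_linears(2) assms(3)])

text \<open>Product rule: \<open>J q (X' Z)\<close> differentiates the argument; the remaining terms
  differentiate \<open>J\<close> itself and depend on \<open>X\<close> only through its value at
  \<open>q\<close>.\<close>

lemma has_derivative_J:
  assumes q: "q \<in> D" and X: "(X has_derivative X') (at q)"
  shows "((\<lambda>p. J p (X p)) has_derivative
    (\<lambda>Z. J q (X' Z) + (hlift q (DN q Z (\<pi> (X q))) - V (DN q Z (vert q (X q)))))) (at q)"
proof -
  note der = bounded_linear.has_derivative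
  have id: "((\<lambda>p. p) has_derivative (\<lambda>Z. Z)) (at q)" by (rule has_derivative_ident)
  have v: "((\<lambda>p. vert p (X p)) has_derivative (\<lambda>Z. vert q (X' Z) + DN q Z (\<pi> (X q)))) (at q)"
    unfolding vert_def
    by (rule has_derivative_eq_rhs[OF has_derivative_add[OF der[OF bounded_linears(4) X]
            has_derivative_N[OF id q der[OF bounded_linears(3) X]]]]) (simp add: algebra_simps)
  show ?thesis
    unfolding J_def hlift_def[of _ "vert _ _"]
    by (rule has_derivative_eq_rhs[OF has_derivative_diff[OF has_derivative_diff[OF
            der[OF bounded_linears(1) v] der[OF bounded_linears(2) has_derivative_N[OF id q v]]]
            der[OF bounded_linears(2) der[OF bounded_linears(3) X]]]])
      (simp add: hlift_def map_simps N_simps[OF q] algebra_simps)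
qed

lemma nijenhuis_eq_curv:
  assumes q: "q \<in> D" and X: "X differentiable at q" and Y: "Y differentiable at q"
  shows "nijenhuis J X Y q =
    hlift q (curv q (vert q (X q)) (\<pi> (Y q)) + curv q (\<pi> (X q)) (vert q (Y q)))
    + V (curv q (\<pi> (X q)) (\<pi> (Y q)) - curv q (vert q (X q)) (vert q (Y q)))"
proof -
  note X = X[unfolded frechet_derivative_works] and Y = Y[unfolded frechet_derivative_works]
  let ?X' = "frechet_derivative X (at q)" and ?Y' = "frechet_derivative Y (at q)"
  define DJ where "DJ Z w = hlift q (DN q Z (\<pi> w)) - V (DN q Z (vert q w))" for Z w
  have JX: "frechet_derivative (\<lambda>p. J p (X p)) (at q) = (\<lambda>Z. J q (?X' Z) + DJ Z (X q))"
    unfolding DJ_def by (rule frechet_derivative_at[OF has_derivative_J[OF q X], symmetric])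
  have JY: "frechet_derivative (\<lambda>p. J p (Y p)) (at q) = (\<lambda>Z. J q (?Y' Z) + DJ Z (Y q))"
    unfolding DJ_def by (rule frechet_derivative_at[OF has_derivative_J[OF q Y], symmetric])
  \<comment> \<open>All derivatives of \<open>X\<close> and \<open>Y\<close> cancel because
    \<open>J\<close> squares to minus the identity; this is the tensoriality of the Nijenhuis
    expression.\<close>
  have 1: "nijenhuis J X Y q = DJ (J q (X q)) (Y q) - DJ (J q (Y q)) (X q)
      + J q (DJ (Y q) (X q)) - J q (DJ (X q) (Y q))"
    unfolding nijenhuis_def lie_bracket_def JX JY
    by (simp add: J_simps[OF q] J_frame(3)[OF q])
  \<comment> \<open>In frame components every surviving term is a horizontal or a vertical
    derivative of \<open>N\<close>. The vertical ones cancel in pairs by the four instances of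
    \<open>DN_vertical_commute\<close>; the horizontal ones group into \<open>curv\<close>.\<close>
  define a b c d where defs: "a = \<pi> (X q)" "b = vert q (X q)" "c = \<pi> (Y q)" "d = vert q (Y q)"
  have XY: "X q = hlift q a + V b" "Y q = hlift q c + V d"
    by (simp_all add: defs frame_decomp)
  show ?thesis
    unfolding 1 DJ_def
    by (simp add: XY J_simps[OF q] J_frame[OF q] frame_simps[OF q] vert_simps[OF q] hlift_simps[OF q]
        map_simps DN_simps[OF q] curv_def
        DN_vertical_commute[OF q, of c a] DN_vertical_commute[OF q, of d b]
        DN_vertical_commute[OF q, of d a] DN_vertical_commute[OF q, of c b])
qed

text \<open>Only the values of the two fields at the point matter, so constant fields extending the
  horizontal vectors \<open>hlift q a\<close> and \<open>hlift q b\<close> suffice: on them the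
  tensor is \<open>V (curv q a b)\<close>, and \<open>\<kappa>\<close> reads off the
  curvature.\<close>

lemma nijenhuis_zero_iff_flat:
  "(\<forall>X Y. smooth_on D X \<and> smooth_on D Y \<longrightarrow> (\<forall>p\<in>D. nijenhuis J X Y p = 0)) \<longleftrightarrow>
   (\<forall>q\<in>D. \<forall>a b. curv q a b = 0)"
proof (intro iffI ballI allI impI)
  fix q a b
  assume nij: "\<forall>X Y. smooth_on D X \<and> smooth_on D Y \<longrightarrow> (\<forall>p\<in>D. nijenhuis J X Y p = 0)"
    and q: "q \<in> D"
  have "nijenhuis J (\<lambda>_. hlift q a) (\<lambda>_. hlift q b) q = 0"
    using nij q smooth_on_const by blast
  then have "\<kappa> (V (curv q a b)) = \<kappa> 0"
    by (simp add: nijenhuis_eq_curv[OF q] frame_simps[OF q] curv_def hlift_simps[OF q] DN_simps[OF q] map_simps)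
  then show "curv q a b = 0" by (simp add: map_simps)
next
  fix X Y :: "'q \<Rightarrow> 'q" and p
  assume flat: "\<forall>q\<in>D. \<forall>a b. curv q a b = 0" and XY: "smooth_on D X \<and> smooth_on D Y" and p: "p \<in> D"
  have "X differentiable at p" "Y differentiable at p"
    using XY p smooth_on_differentiable by blast+
  then show "nijenhuis J X Y p = 0"
    using flat p by (simp add: nijenhuis_eq_curv hlift_simps map_simps)
qed

text \<open>The form \<open>vert\<close> vanishes on all tangent vectors of the integral manifold.
  Differentiating this identity along a second parameter direction and antisymmetrising removes the
  second derivatives of \<open>\<sigma>\<close>; what remains is the curvature on horizontal
  vectors, all of which are tangent.\<close>

lemma integral_manifold_imp_flat:
  fixes \<sigma> :: "'w::euclidean_space \<Rightarrow> 'q"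
  assumes im: "integral_manifold (\<lambda>q. range (hlift q)) W \<sigma>" and w: "w \<in> W" and D: "\<sigma> ` W \<subseteq> D"
  shows "curv (\<sigma> w) a b = 0"
proof -
  have W: "open W" "smooth_on W \<sigma>" and range: "\<And>w. w \<in> W \<Longrightarrow> range (\<lambda>h. dderiv h \<sigma> w) = range (hlift (\<sigma> w))"
    using im by (auto simp: integral_manifold_def dderiv_def)
  have q: "\<sigma> w \<in> D" using D w by blast
  have zero: "vert (\<sigma> v) (dderiv h \<sigma> v) = 0" if v: "v \<in> W" for v h
  proof -
    obtain e where "dderiv h \<sigma> v = hlift (\<sigma> v) e" using range[OF v] by blast
    then show ?thesis using frame_simps[of "\<sigma> v"] D v by auto
  qed
  have eq: "vert (\<sigma> w) (dderiv k (dderiv h \<sigma>) w) + DN (\<sigma> w) (dderiv k \<sigma> w) (\<pi> (dderiv h \<sigma> w)) = 0" for h k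
  proof -
    note d2 = smooth_on_has_derivative[OF smooth_on_dderiv[OF W(2)] w, of h]
    have "((\<lambda>v. vert (\<sigma> v) (dderiv h \<sigma> v)) has_derivative
      (\<lambda>k. \<kappa> (dderiv k (dderiv h \<sigma>) w) + (DN (\<sigma> w) (dderiv k \<sigma> w) (\<pi> (dderiv h \<sigma> w))
         + N (\<sigma> w) (\<pi> (dderiv k (dderiv h \<sigma>) w))))) (at w)"
      unfolding vert_def
      by (intro has_derivative_add has_derivative_N smooth_on_has_derivative[OF W(2) w] q
          bounded_linear.has_derivative[OF bounded_linears(4) d2]
          bounded_linear.has_derivative[OF bounded_linears(3) d2])
    then have "((\<lambda>v. 0) has_derivative
      (\<lambda>k. \<kappa> (dderiv k (dderiv h \<sigma>) w) + (DN (\<sigma> w) (dderiv k \<sigma> w) (\<pi> (dderiv h \<sigma> w))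
         + N (\<sigma> w) (\<pi> (dderiv k (dderiv h \<sigma>) w))))) (at w)"
      by (rule has_derivative_transform_within_open[OF _ W(1) w]) (rule zero)
    from has_derivative_unique[OF this has_derivative_const] show ?thesis
      by (auto simp: vert_def add_ac dest: fun_cong[of _ _ k])
  qed
  have in_range: "hlift (\<sigma> w) c \<in> range (\<lambda>h. dderiv h \<sigma> w)" for c
    unfolding range[OF w] by (rule rangeI)
  obtain h where h: "hlift (\<sigma> w) a = dderiv h \<sigma> w" using in_range[of a] by (rule rangeE)
  obtain k where k: "hlift (\<sigma> w) b = dderiv k \<sigma> w" using in_range[of b] by (rule rangeE)
  show ?thesis
    using eq[of h k] eq[of k h] dderiv_commute[OF W w, of h k]
    by (simp add: curv_def frame_simps[OF q] add_eq_0_iff flip: h k)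
qed

text \<open>The integral manifold through \<open>q\<close> is a graph over a ball in the base;
  \<open>\<iota>\<close> carries it to the parameter space in which integrability is
  phrased.\<close>

lemma flat_imp_integral_manifold:
  fixes \<iota> :: "'w::euclidean_space \<Rightarrow> 'b"
  assumes flat: "\<And>q a b. q \<in> D \<Longrightarrow> curv q a b = 0" and q: "q \<in> D"
    and \<iota>: "bounded_linear \<iota>" "bij \<iota>"
  shows "\<exists>W (\<sigma> :: 'w \<Rightarrow> 'q). integral_manifold (\<lambda>q. range (hlift q)) W \<sigma> \<and> \<sigma> ` W \<subseteq> D \<and> q \<in> \<sigma> ` W"
proof -
  define P where "P z = H (fst z) + V (snd z)" for z :: "'b \<times> 'b"
  have P_Pair: "P (a, b) = H a + V b" for a b by (simp add: P_def)
  have P: "bounded_linear P"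
    unfolding P_def
    by (intro bounded_linear_add bounded_linear_compose[OF bounded_linears(1)]
        bounded_linear_compose[OF bounded_linears(2)] bounded_linear_fst bounded_linear_snd)
  define U where "U = P -` D"
  have U: "open U"
    unfolding U_def using open_D P
    by (simp add: continuous_open_vimage linear_continuous_at)
  have smooth_P: "smooth_on U P" by (rule smooth_on_linear_map[OF P U])
  \<comment> \<open>The graph of \<open>s\<close> is horizontal exactly when its slope is minus the
    connection; the compatibility condition of \<open>frobenius_graph\<close> then says that the
    curvature vanishes.\<close>
  define A where "A z = blinfun_of_basis (\<lambda>e. - N (P z) e)" for z
  have A_apply: "blinfun_apply (A z) e = - N (P z) e" if "z \<in> U" for z e
    unfolding A_def
    by (rule blinfun_of_basis_apply) (use that in \<open>auto simp: U_def linear_N linear_compose_neg\<close>)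
  have A: "smooth_on U A"
    unfolding A_def
    by (intro smooth_on_blinfun_of_basis smooth_on_minus U smooth_on_compose[OF U open_D smooth_N smooth_P])
      (simp add: U_def)
  have A_deriv: "blinfun_apply (dderiv (h, blinfun_apply (A z) h) A z) k = - DN (P z) (hlift (P z) h) k"
    if z: "z \<in> U" for z h k
  proof -
    let ?v = "(h, blinfun_apply (A z) h)"
    have "blinfun_apply (dderiv ?v A z) k = dderiv ?v (\<lambda>z. blinfun_apply (A z) k) z"
      by (rule dderiv_bounded_linear[symmetric, OF blinfun.bounded_linear_left smooth_on_differentiable[OF A z]])
    also have "\<dots> = dderiv ?v (\<lambda>z. - N (P z) k) z"
      by (rule dderiv_cong[OF U _ z]) (rule A_apply)
    also have "\<dots> = - (DN (P z) (P ?v) k + N (P z) 0)"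
      using z by (intro dderivI[OF has_derivative_minus[OF has_derivative_N]] has_derivative_const
          bounded_linear_imp_has_derivative P) (simp add: U_def)
    also have "P ?v = hlift (P z) h"
      by (simp add: P_Pair hlift_def A_apply[OF z] map_simps)
    finally show ?thesis using z by (simp add: U_def N_simps)
  qed
  have P0: "P (\<pi> q, \<kappa> q) = q" by (simp add: P_def split)
  then have "(\<pi> q, \<kappa> q) \<in> U" using q by (simp add: U_def)
  from frobenius_graph[OF U this A]
  obtain r s where r: "0 < r" and s0: "s (\<pi> q) = \<kappa> q"
    and sU: "\<And>x. x \<in> ball (\<pi> q) r \<Longrightarrow> (x, s x) \<in> U"
    and sd: "\<And>x. x \<in> ball (\<pi> q) r \<Longrightarrow> (s has_derivative blinfun_apply (A (x, s x))) (at x)"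
    using flat by (auto simp: A_deriv curv_def U_def)
  define \<tau> where "\<tau> x = P (x, s x)" for x
  have \<tau>: "\<tau> x \<in> D" if "x \<in> ball (\<pi> q) r" for x
    using sU[OF that] by (simp add: \<tau>_def U_def)
  have \<tau>d: "(\<tau> has_derivative hlift (\<tau> x)) (at x)" if x: "x \<in> ball (\<pi> q) r" for x
  proof -
    have "(\<tau> has_derivative (\<lambda>h. P (h, blinfun_apply (A (x, s x)) h))) (at x)"
      unfolding \<tau>_def
      by (rule bounded_linear.has_derivative[OF P has_derivative_Pair[OF has_derivative_ident sd[OF x]]])
    then show ?thesis
      by (rule has_derivative_eq_rhs) (auto simp: A_apply[OF sU[OF x]] P_Pair hlift_def \<tau>_def map_simps)
  qed
  \<comment> \<open>Bootstrapping: so far \<open>\<tau>\<close> is merely differentiable, but its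
    derivative is the smooth map \<open>hlift\<close> evaluated along \<open>\<tau>\<close>, so each
    order of regularity yields the next.\<close>
  have smooth_\<tau>: "smooth_on (ball (\<pi> q) r) \<tau>"
    unfolding smooth_on_def
  proof
    show "Ck_on k \<tau> (ball (\<pi> q) r)" for k
    proof (induction k)
      case 0
      then show ?case
        using \<tau>d by (auto intro!: continuous_at_imp_continuous_on has_derivative_continuous)
    next
      case (Suc k)
      show ?case
      proof (rule Ck_on_SucI[OF open_ball \<tau>d])
        have "Ck_on k (\<lambda>q. hlift q v) D" for v
          using smooth_on_diff[OF open_D smooth_on_const smooth_on_bounded_linear[OF bounded_linears(2) open_D smooth_N]]
          by (simp add: hlift_def smooth_on_def)
        then show "Ck_on k (\<lambda>x. hlift (\<tau> x) v) (ball (\<pi> q) r)" for v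
          by (rule Ck_on_compose[OF open_ball open_D _ Suc]) (use \<tau> in blast)
      qed
    qed
  qed
  define W where "W = \<iota> -` ball (\<pi> q) r"
  define \<sigma> where "\<sigma> w = \<tau> (\<iota> w)" for w
  have W: "open W"
    unfolding W_def using \<iota> by (simp add: continuous_open_vimage linear_continuous_at)
  have \<sigma>d: "(\<sigma> has_derivative (\<lambda>h. hlift (\<sigma> w) (\<iota> h))) (at w)" if "w \<in> W" for w
    using diff_chain_at[OF bounded_linear_imp_has_derivative[OF \<iota>(1)] \<tau>d[of "\<iota> w"]] that
    by (simp add: \<sigma>_def[abs_def] W_def o_def)
  have \<sigma>D: "\<sigma> w \<in> D" if "w \<in> W" for w using that \<tau> by (simp add: \<sigma>_def W_def)
  have \<pi>\<sigma>: "\<pi> (\<sigma> w) = \<iota> w" for w by (simp add: \<sigma>_def \<tau>_def P_def map_simps)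
  have inj_\<iota>: "inj \<iota>" and surj_\<iota>: "surj \<iota>" using \<iota>(2) by (auto simp: bij_def)
  have "integral_manifold (\<lambda>q. range (hlift q)) W \<sigma>"
    unfolding integral_manifold_def
  proof (intro conjI ballI)
    show "open W" by (rule W)
    show "smooth_on W \<sigma>"
      unfolding \<sigma>_def
      by (rule smooth_on_compose[OF W open_ball smooth_\<tau> smooth_on_linear_map[OF \<iota>(1) W]]) (simp add: W_def)
    show "inj_on \<sigma> W" using \<pi>\<sigma> inj_\<iota> by (metis inj_on_def injD)
    fix w assume w: "w \<in> W"
    have fd: "frechet_derivative \<sigma> (at w) = (\<lambda>h. hlift (\<sigma> w) (\<iota> h))"
      by (rule frechet_derivative_at[OF \<sigma>d[OF w], symmetric])
    show "inj (frechet_derivative \<sigma> (at w))"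
      unfolding fd
    proof (rule injI)
      fix a b assume "hlift (\<sigma> w) (\<iota> a) = hlift (\<sigma> w) (\<iota> b)"
      then have "\<pi> (hlift (\<sigma> w) (\<iota> a)) = \<pi> (hlift (\<sigma> w) (\<iota> b))" by simp
      then show "a = b" using inj_\<iota> by (simp add: frame_simps[OF \<sigma>D[OF w]] inj_eq)
    qed
    have "range (\<lambda>h. hlift (\<sigma> w) (\<iota> h)) = hlift (\<sigma> w) ` range \<iota>" by (simp add: image_image)
    then show "range (frechet_derivative \<sigma> (at w)) = range (hlift (\<sigma> w))"
      by (simp add: fd surj_\<iota>)
  qed
  moreover have "q \<in> \<sigma> ` W"
  proof -
    obtain w where w: "\<iota> w = \<pi> q" using surj_\<iota> by (metis surjD)
    then have "w \<in> W" "\<sigma> w = q" using r by (simp_all add: W_def \<sigma>_def \<tau>_def s0 P0)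
    then show ?thesis by blast
  qed
  ultimately show ?thesis using \<sigma>D by blast
qed

end

section \<open>The Kaehler structure of a spray\<close>

lemma ext_deriv2_cong:
  assumes "open S" "\<And>q X Y. q \<in> S \<Longrightarrow> \<omega> q X Y = \<omega>' q X Y" "p \<in> S"
  shows "ext_deriv2 \<omega> p X Y Z = ext_deriv2 \<omega>' p X Y Z"
  unfolding ext_deriv2_def pdiff_eq_dderiv using assms by (intro arg_cong2[of _ _ _ _ "(+)"]
      arg_cong2[of _ _ _ _ "(-)"] dderiv_cong[OF assms(1)]) auto

lemma lie_bracket_cong:
  assumes "open S" "\<And>q. q \<in> S \<Longrightarrow> X q = X' q" "\<And>q. q \<in> S \<Longrightarrow> Y q = Y' q" "p \<in> S"
  shows "lie_bracket X Y p = lie_bracket X' Y' p"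
  using dderiv_cong[OF assms(1,2,4)] dderiv_cong[OF assms(1,3,4)] assms
  by (simp add: lie_bracket_def flip: dderiv_def)

lemma nijenhuis_cong:
  assumes "open S" "\<And>q X. q \<in> S \<Longrightarrow> J q X = J' q X" "p \<in> S"
  shows "nijenhuis J X Y p = nijenhuis J' X Y p"
proof -
  note cong = lie_bracket_cong[OF assms(1) _ _ assms(3)]
  have 1: "lie_bracket (\<lambda>q. J q (X q)) (\<lambda>q. J q (Y q)) p = lie_bracket (\<lambda>q. J' q (X q)) (\<lambda>q. J' q (Y q)) p"
    by (rule cong) (simp_all add: assms(2))
  have 2: "lie_bracket (\<lambda>q. J q (X q)) Y p = lie_bracket (\<lambda>q. J' q (X q)) Y p"
    by (rule cong) (simp_all add: assms(2))
  have 3: "lie_bracket X (\<lambda>q. J q (Y q)) p = lie_bracket X (\<lambda>q. J' q (Y q)) p"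
    by (rule cong) (simp_all add: assms(2))
  show ?thesis unfolding nijenhuis_def 1 2 3 assms(2)[OF assms(3)] ..
qed

text \<open>The coordinate tensors and the abstract ones agree over the slit bundle, where
  everything is smooth; as that set is open, the agreement passes to all derivatives
  involved.\<close>

lemma kaehler_on_cong:
  assumes S: "open S" and J: "\<And>q X. q \<in> S \<Longrightarrow> J q X = J' q X" and G: "\<And>q X Y. q \<in> S \<Longrightarrow> G q X Y = G' q X Y"
  shows "kaehler_on S J G \<longleftrightarrow> kaehler_on S J' G'"
proof -
  have "ext_deriv2 (\<lambda>q X Y. G q X (J q Y)) p X Y Z = ext_deriv2 (\<lambda>q X Y. G' q X (J' q Y)) p X Y Z"
    if "p \<in> S" for p X Y Z
    by (rule ext_deriv2_cong[OF S _ that]) (simp add: J G)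
  then show ?thesis
    unfolding kaehler_on_def by (simp add: J G nijenhuis_cong[OF S J] cong: ball_cong)
qed

section \<open>The Hermitian structure of a Lagrangian spray\<close>

text \<open>
  The last assumption says that \<open>B\<close> are the semi-spray coefficients of \<open>L\<close>; it is written without
  inverting the fibre Hessian of \<open>L\<close>.
\<close>

locale lagrangian_spray = spray H V \<pi> \<kappa> D B
  for H V :: "'b::euclidean_space \<Rightarrow> 'q::euclidean_space" and \<pi> \<kappa> D B +
  fixes L :: "'q \<Rightarrow> real"
  assumes smooth_L: "smooth_on D L"
    and spray_eq: "\<And>q e. q \<in> D \<Longrightarrow> 2 * dderiv (V (B q)) (dderiv (V e) L) q =
      dderiv (H (\<kappa> q)) (dderiv (V e) L) q - dderiv (H e) L q"
begin

text \<open>For the warped Lagrangian this is block diagonal with blocks g and f^2 g, so that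
  \<open>sasaki\<close> becomes the given metric G.\<close>

definition fibre_metric :: "'q \<Rightarrow> 'b \<Rightarrow> 'b \<Rightarrow> real" where
  "fibre_metric q a b = 1/2 * dderiv (V a) (dderiv (V b) L) q"

definition sasaki :: "'q \<Rightarrow> 'q \<Rightarrow> 'q \<Rightarrow> real" where
  "sasaki q X Y = fibre_metric q (\<pi> X) (\<pi> Y) + fibre_metric q (vert q X) (vert q Y)"

lemma smooth_dL: "smooth_on D (dderiv v L)" and smooth_d2L: "smooth_on D (dderiv w (dderiv v L))"
  by (intro smooth_on_dderiv smooth_L)+

lemma d2_commute: "q \<in> D \<Longrightarrow> dderiv v (dderiv w L) q = dderiv w (dderiv v L) q"
  by (rule dderiv_commute[OF open_D smooth_L])

lemma d2_linear: "q \<in> D \<Longrightarrow> linear (\<lambda>w. dderiv w (dderiv v L) q)"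
  by (rule smooth_on_linear_dderiv[OF smooth_dL])

lemma d2_simps:
  assumes q: "q \<in> D"
  shows "dderiv (v + w) (dderiv z L) q = dderiv v (dderiv z L) q + dderiv w (dderiv z L) q"
    "dderiv z (dderiv (v + w) L) q = dderiv z (dderiv v L) q + dderiv z (dderiv w L) q"
    "dderiv (- w) (dderiv z L) q = - dderiv w (dderiv z L) q"
    "dderiv z (dderiv (- w) L) q = - dderiv z (dderiv w L) q"
  using d2_commute[OF q, of z] linear_add[OF d2_linear[OF q, of z]] linear_neg[OF d2_linear[OF q, of z]]
  by simp_all

lemma d3_commute:
  assumes "q \<in> D"
  shows "dderiv u (dderiv v (dderiv w L)) q = dderiv v (dderiv u (dderiv w L)) q"
    "dderiv u (dderiv v (dderiv w L)) q = dderiv u (dderiv w (dderiv v L)) q"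
proof -
  show "dderiv u (dderiv v (dderiv w L)) q = dderiv v (dderiv u (dderiv w L)) q"
    by (rule dderiv_commute[OF open_D smooth_dL assms])
  show "dderiv u (dderiv v (dderiv w L)) q = dderiv u (dderiv w (dderiv v L)) q"
    by (rule dderiv_cong[OF open_D d2_commute assms])
qed

lemma fibre_metric_commute: "q \<in> D \<Longrightarrow> fibre_metric q a b = fibre_metric q b a"
  by (simp add: fibre_metric_def d2_commute[of q "V a"])

lemma fibre_metric_simps:
  assumes "q \<in> D"
  shows "fibre_metric q (a + b) c = fibre_metric q a c + fibre_metric q b c" "fibre_metric q c (a + b) = fibre_metric q c a + fibre_metric q c b"
    "fibre_metric q (- a) c = - fibre_metric q a c" "fibre_metric q c (- a) = - fibre_metric q c a"
  by (simp_all add: fibre_metric_def map_simps d2_simps[OF assms])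

text \<open>
  The vertical derivative of \<open>spray_eq\<close>, antisymmetrised: the third derivatives of \<open>L\<close> cancel.
\<close>

lemma fibre_metric_N_antisym:
  assumes q: "q \<in> D"
  shows "fibre_metric q (N q b) e - fibre_metric q (N q e) b =
    1/2 * (dderiv (H b) (dderiv (V e) L) q - dderiv (H e) (dderiv (V b) L) q)"
proof -
  have "2 * (dderiv (V b) (dderiv (V (B q)) (dderiv (V e) L)) q + dderiv (V (N q b)) (dderiv (V e) L) q) =
    dderiv (V b) (dderiv (H (\<kappa> q)) (dderiv (V e) L)) q + dderiv (H b) (dderiv (V e) L) q
    - dderiv (V b) (dderiv (H e) L) q" for b e
  proof -
    \<comment> \<open>The directions \<open>V (B p)\<close> and \<open>H (\<kappa> p)\<close> in the
      spray equation move with \<open>p\<close>. Their derivatives along \<open>V b\<close> are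
      \<open>V (N q b)\<close> and \<open>H b\<close>; the former is how the connection
      enters.\<close>
    have along: "dderiv (V b) (\<lambda>p. dderiv (E p) (dderiv (V e) L) p) q =
        dderiv (V b) (dderiv (E q) (dderiv (V e) L)) q + dderiv E' (dderiv (V e) L) q"
      and diff: "(\<lambda>p. dderiv (E p) (dderiv (V e) L) p) differentiable at q"
      if "(E has_derivative F) (at q)" "F (V b) = E'" for E F E'
    proof -
      note der = has_derivative_dderiv_along[OF open_D smooth_dL[of "V e"] has_derivative_ident q that(1)]
      show "dderiv (V b) (\<lambda>p. dderiv (E p) (dderiv (V e) L) p) q =
        dderiv (V b) (dderiv (E q) (dderiv (V e) L)) q + dderiv E' (dderiv (V e) L) q"
        unfolding dderivI[OF der] that(2) ..
      show "(\<lambda>p. dderiv (E p) (dderiv (V e) L) p) differentiable at q"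
        by (rule differentiableI[OF der])
    qed
    have EB: "((\<lambda>p. V (B p)) has_derivative (\<lambda>h. V (dderiv h B q))) (at q)"
      by (rule bounded_linear.has_derivative[OF bounded_linears(2) smooth_on_has_derivative[OF smooth_B q]])
    have EH: "((\<lambda>p. H (\<kappa> p)) has_derivative (\<lambda>h. H (\<kappa> h))) (at q)"
      by (intro bounded_linear_imp_has_derivative bounded_linear_compose[OF bounded_linears(1,4)])
    have "dderiv (V b) (\<lambda>p. 2 * dderiv (V (B p)) (dderiv (V e) L) p) q =
      dderiv (V b) (\<lambda>p. dderiv (H (\<kappa> p)) (dderiv (V e) L) p - dderiv (H e) L p) q"
      by (rule dderiv_cong[OF open_D spray_eq q])
    also have "dderiv (V b) (\<lambda>p. 2 * dderiv (V (B p)) (dderiv (V e) L) p) q =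
      2 * (dderiv (V b) (dderiv (V (B q)) (dderiv (V e) L)) q + dderiv (V (N q b)) (dderiv (V e) L) q)"
      unfolding dderiv_bounded_linear[OF bounded_linear_mult_right diff[OF EB refl]]
      by (simp add: along[OF EB refl] N_def)
    also have "dderiv (V b) (\<lambda>p. dderiv (H (\<kappa> p)) (dderiv (V e) L) p - dderiv (H e) L p) q =
      dderiv (V b) (dderiv (H (\<kappa> q)) (dderiv (V e) L)) q + dderiv (H b) (dderiv (V e) L) q
      - dderiv (V b) (dderiv (H e) L) q"
      unfolding dderiv_diff[OF diff[OF EH refl] smooth_on_differentiable[OF smooth_dL q]]
      by (simp add: along[OF EH refl])
    finally show ?thesis .
  qed
  from this[of b e] this[of e b] show ?thesis
    using d3_commute(1)[OF q, of "V b" "V (B q)" "V e"] d3_commute(1)[OF q, of "V e" "V (B q)" "V b"]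
      d3_commute(2)[OF q, of "V (B q)" "V b" "V e"]
      d3_commute(1)[OF q, of "V b" "H (\<kappa> q)" "V e"] d3_commute(1)[OF q, of "V e" "H (\<kappa> q)" "V b"]
      d3_commute(2)[OF q, of "H (\<kappa> q)" "V b" "V e"]
      d2_commute[OF q, of "V b" "H e"] d2_commute[OF q, of "V e" "H b"]
    by (simp add: fibre_metric_def)
qed

text \<open>With \<theta>(X) = \<open>dderiv (V (\<pi> X)) L q\<close> the right-hand side is -1/2
  d\<theta>(X, Y). The \<open>\<kappa>\<close>-parts of \<open>vert\<close> account for the fibre
  derivatives in d\<theta>; its \<open>N\<close>-parts occur antisymmetrised, just as
  \<open>fibre_metric_N_antisym\<close> evaluates them.\<close>

lemma sasaki_J:
  assumes q: "q \<in> D"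
  shows "sasaki q X (J q Y) = 1/2 * (dderiv Y (dderiv (V (\<pi> X)) L) q - dderiv X (dderiv (V (\<pi> Y)) L) q)"
proof -
  have d: "dderiv Z (dderiv (V a) L) q = dderiv (H (\<pi> Z)) (dderiv (V a) L) q + 2 * fibre_metric q (\<kappa> Z) a" for Z a
    by (subst split[of Z, symmetric]) (simp only: d2_simps(1)[OF q], simp add: fibre_metric_def)
  have "sasaki q X (J q Y) = fibre_metric q (\<pi> X) (vert q Y) - fibre_metric q (vert q X) (\<pi> Y)"
    by (simp add: sasaki_def J_frame[OF q] fibre_metric_simps[OF q])
  also have "\<dots> = fibre_metric q (\<kappa> Y) (\<pi> X) - fibre_metric q (\<kappa> X) (\<pi> Y)
      + (fibre_metric q (N q (\<pi> Y)) (\<pi> X) - fibre_metric q (N q (\<pi> X)) (\<pi> Y))"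
    by (simp add: vert_def fibre_metric_simps[OF q] fibre_metric_commute[OF q, of "\<pi> X"])
  also have "\<dots> = 1/2 * (dderiv Y (dderiv (V (\<pi> X)) L) q - dderiv X (dderiv (V (\<pi> Y)) L) q)"
    using d[of Y "\<pi> X"] d[of X "\<pi> Y"] fibre_metric_N_antisym[OF q, of "\<pi> Y" "\<pi> X"] by simp
  finally show ?thesis .
qed

lemma sasaki_hermitian: "q \<in> D \<Longrightarrow> sasaki q (J q X) (J q Y) = sasaki q X Y"
  by (simp add: sasaki_def J_frame fibre_metric_simps)

text \<open>For constant fields the directions \<open>V (\<pi> X)\<close> are constant too, so only
  third derivatives of \<open>L\<close> appear, and they cancel in pairs by symmetry: d d\<theta> =
  0.\<close>

lemma fundamental_form_closed:
  assumes q: "q \<in> D"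
  shows "ext_deriv2 (\<lambda>q X Y. sasaki q X (J q Y)) q X Y Z = 0"
proof -
  let ?\<omega> = "\<lambda>q X Y. 1/2 * (dderiv Y (dderiv (V (\<pi> X)) L) q - dderiv X (dderiv (V (\<pi> Y)) L) q)"
  have d: "dderiv W (\<lambda>q. ?\<omega> q X Y) q = 1/2 * (dderiv W (dderiv Y (dderiv (V (\<pi> X)) L)) q
      - dderiv W (dderiv X (dderiv (V (\<pi> Y)) L)) q)" for W X Y
    using smooth_on_differentiable[OF smooth_d2L q]
    by (subst dderiv_bounded_linear[OF bounded_linear_mult_right]) (simp_all add: dderiv_diff)
  have "ext_deriv2 (\<lambda>q X Y. sasaki q X (J q Y)) q X Y Z = ext_deriv2 ?\<omega> q X Y Z"
    by (rule ext_deriv2_cong[OF open_D sasaki_J q])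
  also have "\<dots> = 0"
    unfolding ext_deriv2_def pdiff_eq_dderiv d
    using d3_commute(1)[OF q, of X Y "V (\<pi> Z)"] d3_commute(1)[OF q, of X Z "V (\<pi> Y)"]
      d3_commute(1)[OF q, of Y Z "V (\<pi> X)"] by (simp add: diff_divide_distrib)
  finally show ?thesis .
qed

lemma kaehler_iff_flat: "kaehler_on D J sasaki \<longleftrightarrow> (\<forall>q\<in>D. \<forall>a b. curv q a b = 0)"
  unfolding kaehler_on_def nijenhuis_zero_iff_flat
  using sasaki_hermitian fundamental_form_closed by blast

end

section \<open>Warped products in coordinates\<close>

lemma matrix_inv_vector_mult:
  fixes A :: "real ^ 'n ^ 'n"
  assumes "det A \<noteq> 0"
  shows "A *v (matrix_inv A *v b) = b"
proof -
  have "\<exists>A'. A ** A' = mat 1 \<and> A' ** A = mat 1"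
    using assms by (simp add: invertible_det_nz[symmetric] invertible_def)
  then have "A ** matrix_inv A = mat 1"
    unfolding matrix_inv_def by (rule someI2_ex) simp
  then show ?thesis by (simp add: matrix_vector_mul_assoc)
qed

lemma pos_def_imp_det_nz:
  fixes A :: "real ^ 'n ^ 'n"
  assumes "\<And>w. w \<noteq> 0 \<Longrightarrow> 0 < w \<bullet> (A *v w)"
  shows "det A \<noteq> 0"
proof -
  have "inj ((*v) A)"
    unfolding linear_injective_0[OF matrix_vector_mul_linear]
    using assms by fastforce
  then show ?thesis
    by (simp add: invertible_det_nz[symmetric] invertible_left_inverse matrix_left_invertible_injective)
qed

text \<open>The inverse matrix is defined by choice and offers no formula to differentiate. Cramer's
  rule gives the solution as quotients of determinants, which are polynomial in the smooth
  entries.\<close>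

lemma smooth_on_solve:
  fixes A :: "'a::real_normed_vector \<Rightarrow> real ^ 'n ^ 'n"
  assumes S: "open S" and A: "\<And>i j. smooth_on S (\<lambda>x. A x $ i $ j)" and b: "\<And>i. smooth_on S (\<lambda>x. b x $ i)"
    and nz: "\<And>x. x \<in> S \<Longrightarrow> det (A x) \<noteq> 0"
  shows "smooth_on S (\<lambda>x. matrix_inv (A x) *v b x)"
proof (rule smooth_on_vec[OF S])
  fix k
  have "smooth_on S (\<lambda>x. det (\<chi> i j. if j = k then b x $ i else A x $ i $ j) / det (A x))"
  proof (intro smooth_on_divide[OF S] smooth_on_det[OF S] A nz)
    show "smooth_on S (\<lambda>x. (\<chi> i j. if j = k then b x $ i else A x $ i $ j) $ i $ j)" for i j
      using A b by (cases "j = k") auto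
  qed
  then show "smooth_on S (\<lambda>x. (matrix_inv (A x) *v b x) $ k)"
  proof (rule smooth_on_cong[OF _ S])
    fix x assume x: "x \<in> S"
    show "det (\<chi> i j. if j = k then b x $ i else A x $ i $ j) / det (A x) = (matrix_inv (A x) *v b x) $ k"
      using cramer[OF nz[OF x], of "matrix_inv (A x) *v b x" "b x"] matrix_inv_vector_mult[OF nz[OF x]]
      by (simp add: vec_eq_iff)
  qed
qed

lemma vec_axis_sum: "(\<Sum>i\<in>UNIV. a $ i *\<^sub>R axis i 1) = (a :: real ^ 'n)"
  by (auto simp: vec_eq_iff axis_def if_distrib cong: if_cong)

lemma linear_axis_sum:
  fixes l :: "real ^ 'n \<Rightarrow> 'b::real_vector"
  assumes "linear l"
  shows "l a = (\<Sum>i\<in>UNIV. a $ i *\<^sub>R l (axis i 1))"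
  by (subst vec_axis_sum[of a, symmetric]) (simp only: linear_sum[OF assms] linear_scale[OF assms])

lemma linear_Pair_right: "linear l \<Longrightarrow> linear (\<lambda>a. l (0, a))"
  and linear_Pair_left: "linear l \<Longrightarrow> linear (\<lambda>a. l (a, 0))"
  by (auto intro!: linearI simp flip: linear_add linear_scale)

section \<open>A single Finsler factor in a bundle chart\<close>

locale finsler_chart =
  fixes F :: "(real ^ 'n::finite) \<times> (real ^ 'n) \<Rightarrow> real" and U :: "(real ^ 'n) set"
  assumes open_U: "open U" and smooth_F: "smooth_on (U \<times> (- {0})) F"
    and pos_def: "\<And>p w. p \<in> U \<times> (- {0}) \<Longrightarrow> w \<noteq> 0 \<Longrightarrow> 0 < w \<bullet> (fund_tensor F p *v w)"
begin

abbreviation "slit \<equiv> U \<times> (- {0 :: real ^ 'n})"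
abbreviation "E \<equiv> \<lambda>p. (F p)\<^sup>2"

text \<open>The semi-spray with its index lowered by \<open>fund_tensor\<close>, hence free of the
  inverse matrix.\<close>

definition spray_rhs :: "(real ^ 'n) \<times> (real ^ 'n) \<Rightarrow> real ^ 'n" where
  "spray_rhs p = (\<chi> h. 1/4 * ((\<Sum>j\<in>UNIV. dderiv (Dy h) (dderiv (Dx j) E) p * snd p $ j) - dderiv (Dx h) E p))"

lemma open_slit: "open slit"
  by (intro open_Times open_U open_Compl closed_singleton)

lemma smooth_E: "smooth_on slit E"
  by (intro smooth_on_power2 open_slit smooth_F)

lemmas smooth_dE = smooth_on_dderiv[OF smooth_E]
lemmas smooth_ddE = smooth_on_dderiv[OF smooth_dE]

lemma det_nz: "p \<in> slit \<Longrightarrow> det (fund_tensor F p) \<noteq> 0"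
  by (rule pos_def_imp_det_nz[OF pos_def])

lemma semispray_eq: "semispray F p = matrix_inv (fund_tensor F p) *v spray_rhs p"
  by (simp add: semispray_def spray_rhs_def matrix_vector_mult_def vec_eq_iff pdiff_eq_dderiv sum_distrib_left
      mult.left_commute)

lemma dderiv_E_linear: "p \<in> slit \<Longrightarrow> linear (\<lambda>v. dderiv v E p)"
  by (rule smooth_on_linear_dderiv[OF smooth_E])

lemma dderiv2_E_linear: "p \<in> slit \<Longrightarrow> linear (\<lambda>v. dderiv v (dderiv w E) p)"
  by (rule smooth_on_linear_dderiv[OF smooth_dE])

lemma dderiv2_E_commute: "p \<in> slit \<Longrightarrow> dderiv v (dderiv w E) p = dderiv w (dderiv v E) p"
  by (rule dderiv_commute[OF open_slit smooth_E])

lemma dderiv2_E_linear2: "p \<in> slit \<Longrightarrow> linear (\<lambda>w. dderiv v (dderiv w E) p)"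
  using dderiv2_E_linear[of p v] by (simp add: dderiv2_E_commute[of p v])

lemma hessian_E:
  assumes p: "p \<in> slit"
  shows "dderiv (0, a) (dderiv (0, b) E) p = 2 * (a \<bullet> (fund_tensor F p *v b))"
proof -
  have "dderiv (0, a) (dderiv (0, b) E) p = (\<Sum>i\<in>UNIV. \<Sum>j\<in>UNIV. a $ i * (b $ j * dderiv (Dy i) (dderiv (Dy j) E) p))"
    by (subst linear_axis_sum[OF linear_Pair_right[OF dderiv2_E_linear[OF p]]],
        subst linear_axis_sum[OF linear_Pair_right[OF dderiv2_E_linear2[OF p]]])
      (simp add: sum_distrib_left)
  also have "\<dots> = 2 * (a \<bullet> (fund_tensor F p *v b))"
    by (simp add: inner_vec_def matrix_vector_mult_def fund_tensor_def pdiff_eq_dderiv sum_distrib_left mult.commute[of "b $ _"])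
  finally show ?thesis .
qed

text \<open>Index-free form of the lowered semi-spray: linearity in both slots collects the
  coordinate sums into the derivatives along \<open>snd p\<close> and \<open>a\<close> that the
  abstract spray equation uses.\<close>

lemma inner_spray_rhs:
  assumes p: "p \<in> slit"
  shows "4 * (a \<bullet> spray_rhs p) = dderiv (snd p, 0) (dderiv (0, a) E) p - dderiv (a, 0) E p"
proof -
  have "dderiv (snd p, 0) (dderiv (0, a) E) p = dderiv (0, a) (dderiv (snd p, 0) E) p"
    by (rule dderiv2_E_commute[OF p])
  also have "\<dots> = (\<Sum>h\<in>UNIV. \<Sum>j\<in>UNIV. a $ h * (snd p $ j * dderiv (Dy h) (dderiv (Dx j) E) p))"
    by (subst linear_axis_sum[OF linear_Pair_right[OF dderiv2_E_linear[OF p]]],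
        subst linear_axis_sum[OF linear_Pair_left[OF dderiv2_E_linear2[OF p]]])
      (simp add: sum_distrib_left)
  finally show ?thesis
    using linear_axis_sum[OF linear_Pair_left[OF dderiv_E_linear[OF p]], of a]
    by (simp add: inner_vec_def spray_rhs_def sum_distrib_left right_diff_distrib sum_subtractf mult_ac)
qed

end

text \<open>Coordinates are stored per factor, as ((x, y), (u, v)). These four maps regroup them
  into base (x, u) and fibre (y, v) of the tangent bundle of the product.\<close>

definition base_emb :: "(real ^ 'n) \<times> (real ^ 'm) \<Rightarrow> ('n::finite, 'm::finite) coords" where
  "base_emb e = ((fst e, 0), (snd e, 0))"
definition fibre_emb :: "(real ^ 'n) \<times> (real ^ 'm) \<Rightarrow> ('n::finite, 'm::finite) coords" where
  "fibre_emb e = ((0, fst e), (0, snd e))"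
definition base_proj :: "('n::finite, 'm::finite) coords \<Rightarrow> (real ^ 'n) \<times> (real ^ 'm)" where
  "base_proj q = (crd_x q, crd_u q)"
definition fibre_proj :: "('n::finite, 'm::finite) coords \<Rightarrow> (real ^ 'n) \<times> (real ^ 'm)" where
  "fibre_proj q = (crd_y q, crd_v q)"

section \<open>The warped product in a pair of bundle charts\<close>

locale warped_charts = M1: finsler_chart F1 U1 + M2: finsler_chart F2 U2
  for F1 :: "(real ^ 'n::finite) \<times> (real ^ 'n) \<Rightarrow> real" and U1
    and F2 :: "(real ^ 'm::finite) \<times> (real ^ 'm) \<Rightarrow> real" and U2 +
  fixes f :: "real ^ 'n \<Rightarrow> real"
  assumes smooth_f: "smooth_on U1 f" and f_nz: "\<And>x. x \<in> U1 \<Longrightarrow> f x \<noteq> 0"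
begin

abbreviation "\<phi> \<equiv> \<lambda>x. (f x)\<^sup>2"

definition slit_bundle :: "('n, 'm) coords set" where
  "slit_bundle = M1.slit \<times> M2.slit"
definition lagrangian :: "('n, 'm) coords \<Rightarrow> real" where
  "lagrangian q = M1.E (fst q) + \<phi> (crd_x q) * M2.E (snd q)"
definition coeffs :: "('n, 'm) coords \<Rightarrow> (real ^ 'n) \<times> (real ^ 'm)" where
  "coeffs q = (B1 F1 f F2 q, B2 F1 f F2 q)"
text \<open>Here and in \<open>rhs2\<close> the coefficients of the product are lowered with the
  metric of the factor alone. For the second factor the fibre metric carries an additional f^2,
  which is why \<open>rhs2\<close> keeps the denominator \<open>4 * \<phi>\<close>.\<close>

definition rhs1 :: "('n, 'm) coords \<Rightarrow> real ^ 'n" where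
  "rhs1 q = (\<chi> j. M1.spray_rhs (fst q) $ j - 1/4 * M2.E (snd q) * dderiv (axis j 1) \<phi> (crd_x q))"
definition rhs2 :: "('n, 'm) coords \<Rightarrow> real ^ 'm" where
  "rhs2 q = (\<chi> b. M2.spray_rhs (snd q) $ b + 1 / (4 * \<phi> (crd_x q)) *
     dderiv (Dy b) M2.E (snd q) * (\<Sum>i\<in>UNIV. dderiv (axis i 1) \<phi> (crd_x q) * crd_y q $ i))"

lemma open_slit_bundle: "open slit_bundle"
  unfolding slit_bundle_def by (intro open_Times M1.open_slit M2.open_slit)

lemma slit_bundleD: "q \<in> slit_bundle \<Longrightarrow> fst q \<in> M1.slit" "q \<in> slit_bundle \<Longrightarrow> snd q \<in> M2.slit" "q \<in> slit_bundle \<Longrightarrow> crd_x q \<in> U1"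
  by (auto simp: slit_bundle_def)

lemma smooth_phi: "smooth_on U1 \<phi>"
  by (intro smooth_on_power2 M1.open_U smooth_f)

lemma coordinate_maps: "bounded_linear fst" "bounded_linear snd" "bounded_linear (\<lambda>q. crd_x q)" "bounded_linear (\<lambda>q. crd_y q)"
  by (auto intro: bounded_linear_fst bounded_linear_snd bounded_linear_compose[of fst fst]
      bounded_linear_compose[of snd fst] simp: o_def)

lemma smooth_pullback:
  fixes g :: "_ \<Rightarrow> real"
  shows "smooth_on M1.slit g \<Longrightarrow> smooth_on slit_bundle (\<lambda>q. g (fst q))"
    and "smooth_on M2.slit h \<Longrightarrow> smooth_on slit_bundle (\<lambda>q. (h (snd q) :: real))"
    and "smooth_on U1 k \<Longrightarrow> smooth_on slit_bundle (\<lambda>q. (k (crd_x q) :: real))"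
  by (auto intro: smooth_on_compose[OF open_slit_bundle M1.open_slit] smooth_on_compose[OF open_slit_bundle M2.open_slit]
      smooth_on_compose[OF open_slit_bundle M1.open_U] smooth_on_linear_map[OF coordinate_maps(1) open_slit_bundle]
      smooth_on_linear_map[OF coordinate_maps(2) open_slit_bundle] smooth_on_linear_map[OF coordinate_maps(3) open_slit_bundle]
      dest: slit_bundleD)

text \<open>Stated for the general shape g(x, y) + k(x) h(u, v), since fibre derivatives of the
  Lagrangian have this shape again with the same \<open>k\<close>; the rule thus serves for first
  and second derivatives.\<close>

lemma dderiv_warped:
  assumes q: "q \<in> slit_bundle" and g: "smooth_on M1.slit g" and k: "smooth_on U1 k" and h: "smooth_on M2.slit h"
  shows "dderiv w (\<lambda>q. g (fst q) + k (crd_x q) * h (snd q)) q =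
    (dderiv (fst w) g (fst q) + dderiv (crd_x w) k (crd_x q) * h (snd q)
      + k (crd_x q) * dderiv (snd w) h (snd q) :: real)"
proof -
  have lin: "(l has_derivative l) (at q)" if "bounded_linear l" for l :: "('n, 'm) coords \<Rightarrow> 'c::real_normed_vector"
    by (rule bounded_linear_imp_has_derivative[OF that])
  have "((\<lambda>q. g (fst q)) has_derivative (\<lambda>w. dderiv (fst w) g (fst q))) (at q)"
    "((\<lambda>q. h (snd q)) has_derivative (\<lambda>w. dderiv (snd w) h (snd q))) (at q)"
    "((\<lambda>q. k (crd_x q)) has_derivative (\<lambda>w. dderiv (crd_x w) k (crd_x q))) (at q)"
    using diff_chain_at[OF lin[OF coordinate_maps(1)] smooth_on_has_derivative[OF g slit_bundleD(1)[OF q]]]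
      diff_chain_at[OF lin[OF coordinate_maps(2)] smooth_on_has_derivative[OF h slit_bundleD(2)[OF q]]]
      diff_chain_at[OF lin[OF coordinate_maps(3)] smooth_on_has_derivative[OF k slit_bundleD(3)[OF q]]]
    by (simp_all add: o_def)
  from dderivI[OF has_derivative_add[OF this(1) has_derivative_mult[OF this(3,2)]], of w]
  show ?thesis by simp
qed

lemma B1_eq: "B1 F1 f F2 q = matrix_inv (fund_tensor F1 (fst q)) *v rhs1 q"
  by (simp add: B1_def rhs1_def M1.semispray_eq matrix_vector_mult_def vec_eq_iff pdiff_eq_dderiv
      right_diff_distrib sum_subtractf sum_distrib_left mult_ac)

lemma B2_eq: "B2 F1 f F2 q = matrix_inv (fund_tensor F2 (snd q)) *v rhs2 q"
  by (simp add: B2_def rhs2_def M2.semispray_eq matrix_vector_mult_def vec_eq_iff pdiff_eq_dderiv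
      distrib_left sum.distrib sum_distrib_left sum_divide_distrib mult_ac)

lemma smooth_coeffs: "smooth_on slit_bundle coeffs"
proof -
  have y: "smooth_on slit_bundle (\<lambda>q. crd_y q $ i)" for i
    by (rule smooth_on_linear_map[OF bounded_linear_compose[OF bounded_linear_vec_nth coordinate_maps(4)] open_slit_bundle])
  have v: "smooth_on slit_bundle (\<lambda>q. crd_v q $ i)" for i
    by (rule smooth_on_linear_map[OF bounded_linear_compose[OF bounded_linear_vec_nth
          bounded_linear_compose[OF bounded_linear_snd bounded_linear_snd]] open_slit_bundle])
  have s1: "smooth_on slit_bundle (\<lambda>q. M1.spray_rhs (fst q) $ i)" for i
    unfolding M1.spray_rhs_def vec_lambda_beta
    by (intro smooth_on_mult smooth_on_const smooth_on_diff smooth_on_sum y open_slit_bundle smooth_pullback(1)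
        M1.smooth_dE M1.smooth_ddE)
  have s2: "smooth_on slit_bundle (\<lambda>q. M2.spray_rhs (snd q) $ i)" for i
    unfolding M2.spray_rhs_def vec_lambda_beta
    by (intro smooth_on_mult smooth_on_const smooth_on_diff smooth_on_sum v open_slit_bundle smooth_pullback(2)
        M2.smooth_dE M2.smooth_ddE)
  have r1: "smooth_on slit_bundle (\<lambda>q. rhs1 q $ i)" for i
    unfolding rhs1_def vec_lambda_beta
    by (intro smooth_on_mult smooth_on_const smooth_on_diff s1 open_slit_bundle smooth_pullback(2,3)
        M2.smooth_E smooth_on_dderiv smooth_phi)
  have r2: "smooth_on slit_bundle (\<lambda>q. rhs2 q $ i)" for i
    unfolding rhs2_def vec_lambda_beta
    by (intro smooth_on_mult smooth_on_const smooth_on_add smooth_on_sum smooth_on_divide s2 y open_slit_bundle smooth_pullback(2,3)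
        M2.smooth_E smooth_on_dderiv smooth_phi) (use f_nz in \<open>auto dest: slit_bundleD\<close>)
  have g: "smooth_on slit_bundle (\<lambda>q. fund_tensor F1 (fst q) $ i $ j)" "smooth_on slit_bundle (\<lambda>q. fund_tensor F2 (snd q) $ k $ l)" for i j k l
    unfolding fund_tensor_def vec_lambda_beta pdiff_eq_dderiv
    by (intro smooth_on_mult smooth_on_const open_slit_bundle smooth_pullback(1,2) M1.smooth_ddE M2.smooth_ddE)+
  show ?thesis
    unfolding coeffs_def B1_eq B2_eq
    by (intro smooth_on_Pair smooth_on_solve open_slit_bundle g r1 r2 M1.det_nz M2.det_nz slit_bundleD)
qed

lemma smooth_lagrangian: "smooth_on slit_bundle lagrangian"
  unfolding lagrangian_def
  by (intro smooth_on_add smooth_on_mult open_slit_bundle smooth_pullback M1.smooth_E M2.smooth_E smooth_phi)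

lemma phi_linear: "x \<in> U1 \<Longrightarrow> linear (\<lambda>a. dderiv a \<phi> x)"
  by (rule smooth_on_linear_dderiv[OF smooth_phi])

lemma dderiv_lagrangian:
  "q \<in> slit_bundle \<Longrightarrow> dderiv w lagrangian q = dderiv (fst w) M1.E (fst q)
    + dderiv (crd_x w) \<phi> (crd_x q) * M2.E (snd q) + \<phi> (crd_x q) * dderiv (snd w) M2.E (snd q)"
  unfolding lagrangian_def[abs_def] by (rule dderiv_warped[OF _ M1.smooth_E smooth_phi M2.smooth_E])

lemma dderiv2_lagrangian:
  assumes q: "q \<in> slit_bundle"
  shows "dderiv w (dderiv (fibre_emb e) lagrangian) q = dderiv (fst w) (dderiv (0, fst e) M1.E) (fst q)
    + dderiv (crd_x w) \<phi> (crd_x q) * dderiv (0, snd e) M2.E (snd q)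
    + \<phi> (crd_x q) * dderiv (snd w) (dderiv (0, snd e) M2.E) (snd q)"
proof -
  have "dderiv w (dderiv (fibre_emb e) lagrangian) q =
    dderiv w (\<lambda>q. dderiv (0, fst e) M1.E (fst q) + \<phi> (crd_x q) * dderiv (0, snd e) M2.E (snd q)) q"
    by (rule dderiv_cong[OF open_slit_bundle _ q])
      (simp add: dderiv_lagrangian fibre_emb_def linear_0[OF phi_linear[OF slit_bundleD(3)]])
  also have "\<dots> = dderiv (fst w) (dderiv (0, fst e) M1.E) (fst q)
    + dderiv (crd_x w) \<phi> (crd_x q) * dderiv (0, snd e) M2.E (snd q)
    + \<phi> (crd_x q) * dderiv (snd w) (dderiv (0, snd e) M2.E) (snd q)"
    by (rule dderiv_warped[OF q M1.smooth_dE smooth_phi M2.smooth_dE])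
  finally show ?thesis .
qed

lemma inner_rhs1:
  assumes q: "q \<in> slit_bundle"
  shows "4 * (a \<bullet> rhs1 q) = 4 * (a \<bullet> M1.spray_rhs (fst q)) - M2.E (snd q) * dderiv a \<phi> (crd_x q)"
  using linear_axis_sum[OF phi_linear[OF slit_bundleD(3)[OF q]], of a]
  by (simp add: rhs1_def inner_vec_def right_diff_distrib sum_subtractf sum_distrib_left mult_ac)

lemma inner_rhs2:
  assumes q: "q \<in> slit_bundle"
  shows "4 * \<phi> (crd_x q) * (b \<bullet> rhs2 q) = 4 * \<phi> (crd_x q) * (b \<bullet> M2.spray_rhs (snd q))
    + dderiv (0, b) M2.E (snd q) * dderiv (crd_y q) \<phi> (crd_x q)"
proof -
  have y: "(\<Sum>i\<in>UNIV. dderiv (axis i 1) \<phi> (crd_x q) * crd_y q $ i) = dderiv (crd_y q) \<phi> (crd_x q)"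
    using linear_axis_sum[OF phi_linear[OF slit_bundleD(3)[OF q]], of "crd_y q"] by (simp add: mult.commute)
  have b: "b \<bullet> (\<chi> i. dderiv (Dy i) M2.E (snd q)) = dderiv (0, b) M2.E (snd q)"
    using linear_axis_sum[OF linear_Pair_right[OF M2.dderiv_E_linear[OF slit_bundleD(2)[OF q]]], of b]
    by (simp add: inner_vec_def)
  have "rhs2 q = M2.spray_rhs (snd q) +
    (1 / (4 * \<phi> (crd_x q)) * dderiv (crd_y q) \<phi> (crd_x q)) *\<^sub>R (\<chi> i. dderiv (Dy i) M2.E (snd q))"
    unfolding rhs2_def y by (simp add: vec_eq_iff)
  then have "b \<bullet> rhs2 q = b \<bullet> M2.spray_rhs (snd q)
    + 1 / (4 * \<phi> (crd_x q)) * dderiv (crd_y q) \<phi> (crd_x q) * dderiv (0, b) M2.E (snd q)"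
    by (simp add: inner_add_right b)
  then show ?thesis using f_nz[OF slit_bundleD(3)[OF q]] by (simp add: field_simps)
qed

text \<open>Fibre directions leave \<open>crd_x\<close> fixed, so the derivative of
  \<open>\<phi>\<close> drops out and no mixed block between the factors arises.\<close>

lemma fibre_hessian:
  assumes q: "q \<in> slit_bundle"
  shows "dderiv (fibre_emb a) (dderiv (fibre_emb b) lagrangian) q =
    2 * (fst a \<bullet> (fund_tensor F1 (fst q) *v fst b)) + 2 * \<phi> (crd_x q) * (snd a \<bullet> (fund_tensor F2 (snd q) *v snd b))"
  unfolding dderiv2_lagrangian[OF q]
  by (simp add: fibre_emb_def M1.hessian_E[OF slit_bundleD(1)[OF q]] M2.hessian_E[OF slit_bundleD(2)[OF q]]
      linear_0[OF phi_linear[OF slit_bundleD(3)[OF q]]])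

text \<open>This certifies that the explicit B^i and B^\<alpha> are the semi-spray coefficients of
  F. The F_2^2-term of B^i balances the base derivative of f^2 F_2^2; the additional term of
  B^\<alpha> balances the derivative of f^2 along y in the mixed second derivative.\<close>

lemma lagrangian_spray_eq:
  assumes q: "q \<in> slit_bundle"
  shows "2 * dderiv (fibre_emb (coeffs q)) (dderiv (fibre_emb e) lagrangian) q =
    dderiv (base_emb (fibre_proj q)) (dderiv (fibre_emb e) lagrangian) q - dderiv (base_emb e) lagrangian q"
proof -
  \<comment> \<open>The order is exchanged so that \<open>coeffs q\<close> stands in the slot
    multiplied by \<open>fund_tensor\<close> in \<open>fibre_hessian\<close>; there the matrix
    cancels against its inverse.\<close>
  have "dderiv (fibre_emb (coeffs q)) (dderiv (fibre_emb e) lagrangian) q =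
    dderiv (fibre_emb e) (dderiv (fibre_emb (coeffs q)) lagrangian) q"
    by (rule dderiv_commute[OF open_slit_bundle smooth_lagrangian q])
  also have "\<dots> = 2 * (fst e \<bullet> rhs1 q) + 2 * \<phi> (crd_x q) * (snd e \<bullet> rhs2 q)"
    unfolding fibre_hessian[OF q]
    by (simp add: coeffs_def B1_eq B2_eq matrix_inv_vector_mult M1.det_nz M2.det_nz slit_bundleD[OF q])
  also have "2 * \<dots> = 4 * (fst e \<bullet> rhs1 q) + 4 * \<phi> (crd_x q) * (snd e \<bullet> rhs2 q)" by simp
  also have "\<dots> = dderiv (base_emb (fibre_proj q)) (dderiv (fibre_emb e) lagrangian) q - dderiv (base_emb e) lagrangian q"
    unfolding inner_rhs1[OF q] inner_rhs2[OF q] dderiv2_lagrangian[OF q] dderiv_lagrangian[OF q]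
    using M1.inner_spray_rhs[OF slit_bundleD(1)[OF q], of "fst e"] arg_cong[OF M2.inner_spray_rhs[OF slit_bundleD(2)[OF q], of "snd e"], of "(*) (\<phi> (crd_x q))"]
    by (simp add: base_emb_def fibre_proj_def algebra_simps)
  finally show ?thesis .
qed

sublocale lagrangian_spray base_emb fibre_emb base_proj fibre_proj slit_bundle coeffs lagrangian
proof (intro lagrangian_spray.intro spray.intro lagrangian_spray_axioms.intro)
  show "bounded_linear (base_emb :: _ \<Rightarrow> ('n, 'm) coords)" "bounded_linear (fibre_emb :: _ \<Rightarrow> ('n, 'm) coords)"
    "bounded_linear (base_proj :: ('n, 'm) coords \<Rightarrow> _)" "bounded_linear (fibre_proj :: ('n, 'm) coords \<Rightarrow> _)"
    unfolding linear_conv_bounded_linear[symmetric]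
    by (auto intro!: linearI simp: base_emb_def fibre_emb_def base_proj_def fibre_proj_def)
qed (simp_all add: open_slit_bundle smooth_coeffs smooth_lagrangian lagrangian_spray_eq,
    simp_all add: base_emb_def fibre_emb_def base_proj_def fibre_proj_def prod_eq_iff)

section \<open>Dictionary between coordinate expressions and the abstract connection\<close>

lemma coeffs_deriv:
  assumes q: "q \<in> slit_bundle"
  shows "dderiv e coeffs q = (N1 e F1 f F2 q, N2 e F1 f F2 q)"
proof -
  have "pdiff e (\<lambda>p. l (coeffs p)) q = l (dderiv e coeffs q)" if "bounded_linear l" for l :: "_ \<Rightarrow> real"
    unfolding pdiff_eq_dderiv by (rule dderiv_bounded_linear[OF that smooth_on_differentiable[OF smooth_coeffs q]])
  from this[OF bounded_linear_compose[OF bounded_linear_vec_nth bounded_linear_fst]]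
    this[OF bounded_linear_compose[OF bounded_linear_vec_nth bounded_linear_snd]]
  show ?thesis by (simp add: N1_def N2_def coeffs_def prod_eq_iff vec_eq_iff)
qed

lemma base_axis_sum:
  fixes l :: "(real ^ 'n) \<times> (real ^ 'm) \<Rightarrow> 'c::real_vector"
  assumes "linear l"
  shows "l e = (\<Sum>i\<in>UNIV. fst e $ i *\<^sub>R l (axis i 1, 0)) + (\<Sum>a\<in>UNIV. snd e $ a *\<^sub>R l (0, axis a 1))"
  using linear_add[OF assms, of "(fst e, 0)" "(0, snd e)"]
    linear_axis_sum[OF linear_Pair_left[OF assms], of "fst e"]
    linear_axis_sum[OF linear_Pair_right[OF assms], of "snd e"]
  by simp

lemma N_axis:
  assumes "q \<in> slit_bundle"
  shows "N q (axis i 1, 0) = (N1 (ey i) F1 f F2 q, N2 (ey i) F1 f F2 q)"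
    and "N q (0, axis a 1) = (N1 (ev a) F1 f F2 q, N2 (ev a) F1 f F2 q)"
  by (simp_all add: N_def fibre_emb_def coeffs_deriv[OF assms] flip: zero_prod_def)

lemma delta_eq_hlift:
  assumes "q \<in> slit_bundle"
  shows "delta_x i F1 f F2 q = hlift q (axis i 1, 0)" "delta_u a F1 f F2 q = hlift q (0, axis a 1)"
  by (simp_all add: prod_eq_iff delta_x_coords delta_u_coords hlift_def N_axis[OF assms] base_emb_def fibre_emb_def)

lemma delta_form_eq_vert:
  assumes q: "q \<in> slit_bundle"
  shows "delta_y_form i F1 f F2 q w = fst (vert q w) $ i" "delta_v_form a F1 f F2 q w = snd (vert q w) $ a"
  unfolding vert_def base_axis_sum[OF linear_N[OF q], of "base_proj w"] N_axis[OF q]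
  by (simp_all add: delta_y_form_def delta_v_form_def fst_sum snd_sum base_proj_def fibre_proj_def mult.commute)

lemma acs_eq_J:
  assumes q: "q \<in> slit_bundle"
  shows "acs F1 f F2 q w = J q w"
proof -
  have "linear (fibre_emb :: _ \<Rightarrow> ('n, 'm) coords)" by (rule linears(2))
  from base_axis_sum[OF this, of "base_proj w"] base_axis_sum[OF linear_hlift[OF q], of "vert q w"]
  show ?thesis
    unfolding acs_def J_def
    by (simp add: delta_eq_hlift[OF q] delta_form_eq_vert[OF q] base_proj_def fibre_emb_def sum_subtractf
        flip: zero_prod_def)
qed

lemma fibre_metric_coords:
  assumes q: "q \<in> slit_bundle"
  shows "fibre_metric q a b =
    (\<Sum>i\<in>UNIV. \<Sum>j\<in>UNIV. fund_tensor F1 (fst q) $ i $ j * fst a $ i * fst b $ j) +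
    (\<Sum>i\<in>UNIV. \<Sum>j\<in>UNIV. (f (crd_x q))\<^sup>2 * fund_tensor F2 (snd q) $ i $ j * snd a $ i * snd b $ j)"
  unfolding fibre_metric_def fibre_hessian[OF q]
  by (simp add: inner_vec_def matrix_vector_mult_def sum_distrib_left mult_ac)

lemma sasaki_metric_eq:
  assumes q: "q \<in> slit_bundle"
  shows "sasaki_metric F1 f F2 q w z = sasaki q w z"
  unfolding sasaki_def fibre_metric_coords[OF q] sasaki_metric_def
  by (simp add: delta_form_eq_vert[OF q] base_proj_def)

lemma horizontal_space_eq:
  assumes q: "q \<in> slit_bundle"
  shows "horizontal_space F1 f F2 q = range (hlift q)"
proof -
  define b :: "'n + 'm \<Rightarrow> (real ^ 'n) \<times> (real ^ 'm)" where
    "b k = (case k of Inl i \<Rightarrow> (axis i 1, 0) | Inr a \<Rightarrow> (0, axis a 1))" for k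
  have "horizontal_frame k F1 f F2 q = hlift q (b k)" for k
    by (cases k) (simp_all add: horizontal_frame_def b_def delta_eq_hlift[OF q])
  then have "horizontal_space F1 f F2 q = span (hlift q ` range b)"
    by (simp add: horizontal_space_def image_image)
  also have "\<dots> = hlift q ` span (range b)"
    by (rule linear_span_image[OF linear_hlift[OF q]])
  also have "span (range b) = UNIV"
  proof -
    have "(axis i 1, 0) \<in> range b" "(0, axis a 1) \<in> range b" for i a
      by (auto simp: b_def image_iff intro: exI[of _ "Inl i"] exI[of _ "Inr a"])
    then have "e \<in> span (range b)" for e
      using base_axis_sum[OF linear_ident, of e]
      by (metis (no_types, lifting) span_add span_base span_scale span_sum)
    then show ?thesis by auto
  qed
  finally show ?thesis .
qed

lemma kaehler_iff_integrable:
  "kaehler_on slit_bundle (acs F1 f F2) (sasaki_metric F1 f F2) \<longleftrightarrow>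
   integrable_on_coords slit_bundle (horizontal_space F1 f F2)"
proof -
  \<comment> \<open>Integral manifolds are parametrised by vectors indexed by the sum type, whereas
    the base is a product of two vector spaces; \<open>\<iota>\<close> splits the index set.\<close>
  define \<iota> :: "real ^ ('n + 'm) \<Rightarrow> (real ^ 'n) \<times> (real ^ 'm)" where
    "\<iota> w = ((\<chi> i. w $ Inl i), (\<chi> a. w $ Inr a))" for w
  have "linear \<iota>" by (rule linearI) (simp_all add: \<iota>_def vec_eq_iff)
  then have \<iota>: "bounded_linear \<iota>" by (simp add: linear_conv_bounded_linear)
  have bij: "bij \<iota>"
  proof (rule bij_betw_byWitness[of _ "\<lambda>e. \<chi> k. case k of Inl i \<Rightarrow> fst e $ i | Inr a \<Rightarrow> snd e $ a"])
    show "\<forall>w\<in>UNIV. (\<chi> k. case k of Inl i \<Rightarrow> fst (\<iota> w) $ i | Inr a \<Rightarrow> snd (\<iota> w) $ a) = w"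
      by (auto simp: \<iota>_def vec_eq_iff split: sum.split)
  qed (auto simp: \<iota>_def vec_eq_iff)
  \<comment> \<open>The two descriptions of the distribution are identified over the slit bundle,
    hence the restriction on the image of \<open>\<sigma>\<close>.\<close>
  have im: "integral_manifold (horizontal_space F1 f F2) W \<sigma> \<longleftrightarrow> integral_manifold (\<lambda>q. range (hlift q)) W \<sigma>"
    if "\<sigma> ` W \<subseteq> slit_bundle" for W and \<sigma> :: "real ^ ('n + 'm) \<Rightarrow> ('n, 'm) coords"
  proof -
    have "horizontal_space F1 f F2 (\<sigma> w) = range (hlift (\<sigma> w))" if "w \<in> W" for w
      using that \<open>\<sigma> ` W \<subseteq> slit_bundle\<close> by (intro horizontal_space_eq) blast
    then show ?thesis by (simp add: integral_manifold_def)
  qed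
  have "kaehler_on slit_bundle (acs F1 f F2) (sasaki_metric F1 f F2) \<longleftrightarrow> kaehler_on slit_bundle J sasaki"
    by (rule kaehler_on_cong[OF open_slit_bundle acs_eq_J sasaki_metric_eq])
  also have "\<dots> \<longleftrightarrow> (\<forall>q\<in>slit_bundle. \<forall>a b. curv q a b = 0)"
    by (rule kaehler_iff_flat)
  also have "\<dots> \<longleftrightarrow> integrable_on_coords slit_bundle (horizontal_space F1 f F2)"
    unfolding integrable_on_coords_def
  proof (intro iffI ballI allI)
    fix q assume "\<forall>q\<in>slit_bundle. \<forall>a b. curv q a b = 0" "q \<in> slit_bundle"
    then obtain W and \<sigma> :: "real ^ ('n + 'm) \<Rightarrow> ('n, 'm) coords"
      where "integral_manifold (\<lambda>q. range (hlift q)) W \<sigma>" "\<sigma> ` W \<subseteq> slit_bundle" "q \<in> \<sigma> ` W"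
      using flat_imp_integral_manifold[OF _ _ \<iota> bij, of q] by blast
    then show "\<exists>W (\<sigma> :: real ^ ('n + 'm) \<Rightarrow> ('n, 'm) coords).
        integral_manifold (horizontal_space F1 f F2) W \<sigma> \<and> \<sigma> ` W \<subseteq> slit_bundle \<and> q \<in> \<sigma> ` W"
      using im by blast
  next
    fix q a b
    assume ex: "\<forall>q\<in>slit_bundle. \<exists>W (\<sigma> :: real ^ ('n + 'm) \<Rightarrow> ('n, 'm) coords).
        integral_manifold (horizontal_space F1 f F2) W \<sigma> \<and> \<sigma> ` W \<subseteq> slit_bundle \<and> q \<in> \<sigma> ` W"
      and q: "q \<in> slit_bundle"
    from bspec[OF ex q] obtain W and \<sigma> :: "real ^ ('n + 'm) \<Rightarrow> ('n, 'm) coords"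
      where W: "integral_manifold (horizontal_space F1 f F2) W \<sigma>" "\<sigma> ` W \<subseteq> slit_bundle" and w: "q \<in> \<sigma> ` W"
      by (elim exE conjE)
    from w obtain w where "q = \<sigma> w" "w \<in> W" by (rule imageE)
    then show "curv q a b = 0"
      using integral_manifold_imp_flat[OF im[THEN iffD1, OF W(2,1)] _ W(2)] by simp
  qed
  finally show ?thesis .
qed

end

section \<open>From charts to manifolds\<close>

lemma finsler_chartI:
  assumes "finsler_manifold X A F" "c \<in> A"
  shows "finsler_chart (F \<circ> tangent_of A c) (chart_image c)"
  using assms unfolding finsler_manifold_def smooth_manifold_def slit_dom_def
  by unfold_locales blast+

theorem corollary4p1:
  fixes X1 :: "'a topology" and A1 :: "('a, 'n::finite) chart set"
    and X2 :: "'b topology" and A2 :: "('b, 'm::finite) chart set"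
    and F1 :: "'a \<times> ('a, 'n) tangent \<Rightarrow> real" and F2 :: "'b \<times> ('b, 'm) tangent \<Rightarrow> real"
    and f :: "'a \<Rightarrow> real"
    and F :: "('a \<times> ('a, 'n) tangent) \<times> ('b \<times> ('b, 'm) tangent) \<Rightarrow> real"
  assumes "finsler_manifold X1 A1 F1"
    and "finsler_manifold X2 A2 F2"
    and "smooth_function A1 f"
    and "\<forall>p\<in>topspace X1. f p \<noteq> 0"
    and "F = warped_metric F1 f F2"
  shows "warped_kaehler A1 F1 f A2 F2 \<longleftrightarrow> horizontal_integrable A1 F1 f A2 F2"
proof -
  \<comment> \<open>Both sides of the theorem quantify over the same pairs of charts, so the
    equivalence is proved for each pair separately.\<close>
  have "kaehler_on (bundle_dom c d)
       (acs (F1 \<circ> tangent_of A1 c) (f \<circ> chart_inv c) (F2 \<circ> tangent_of A2 d))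
       (sasaki_metric (F1 \<circ> tangent_of A1 c) (f \<circ> chart_inv c) (F2 \<circ> tangent_of A2 d)) \<longleftrightarrow>
     integrable_on_coords (bundle_dom c d)
       (horizontal_space (F1 \<circ> tangent_of A1 c) (f \<circ> chart_inv c) (F2 \<circ> tangent_of A2 d))"
    if c: "c \<in> A1" and d: "d \<in> A2" for c d
  proof -
    have nz: "(f \<circ> chart_inv c) x \<noteq> 0" if "x \<in> chart_image c" for x
    proof -
      have "chart_inv c x \<in> fst c"
        using that by (auto simp: chart_inv_def chart_image_def intro: inv_into_into)
      moreover have "fst c \<subseteq> topspace X1"
        using assms(1) c by (auto simp: finsler_manifold_def smooth_manifold_def)
      ultimately show ?thesis using assms(4) by auto
    qed
    interpret M1: finsler_chart "F1 \<circ> tangent_of A1 c" "chart_image c"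
      by (rule finsler_chartI[OF assms(1) c])
    interpret M2: finsler_chart "F2 \<circ> tangent_of A2 d" "chart_image d"
      by (rule finsler_chartI[OF assms(2) d])
    interpret warped_charts "F1 \<circ> tangent_of A1 c" "chart_image c" "F2 \<circ> tangent_of A2 d" "chart_image d"
      "f \<circ> chart_inv c"
      by unfold_locales (use assms(3) c nz in \<open>auto simp: smooth_function_def\<close>)
    have "bundle_dom c d = slit_bundle"
      by (simp add: bundle_dom_def slit_dom_def slit_bundle_def)
    then show ?thesis using kaehler_iff_integrable by simp
  qed
  then show ?thesis
    by (simp add: warped_kaehler_def horizontal_integrable_def)
qed

end
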